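(* Let $L(s)$ be a Dirichlet series with the following properties: (I) $L(s)=\sum_{n=1}^\infty \frac{a(n)}{n^s}$ is absolutely convergent for $\sigma>1$; (II) $\log L(s)=\sum_p\sum_{k=1}^\infty \frac{b(p^k)}{p^{ks}}$ is absolutely convergent for $\sigma>1$, and there exist $K>0$ and $\theta<1/2$ such that $|b(p^k)|\leq K p^{k\theta}$ for every prime $p$ and every integer $k\geq 1$; (III) $\sum_p |a(p)|p^{-\sigma}\to\infty$ when $\sigma\to 1^+$. Then $L(s)+L(2s)+\cdots+L(Ns)$ has infinitely many zeros in the half-plane $\sigma>1$ if $N=2$, and also for every sufficiently large integer $N$ (that is, for all $N\ge N_0$, with $N_0$ depending on $L$). If furthermore $|a(n)|\leq n^{1/4}$ for every $n\geq 2$, then $L(s)+L(2s)+\cdots+L(Ns)$ has infinitely many zeros in the half-plane $\sigma>1$ for every integer $N\geq 2$.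
   Context: Write $s=\sigma+it$ with $\sigma,t\in\mathbb{R}$. The coefficients $a(n)$, $b(p^k)$ are complex numbers; $p$ runs over the primes. Condition (II) means that the displayed double series converges absolutely for $\sigma>1$ and that $L(s)$ equals its exponential there; this series defines $\log L(s)$. For a positive integer $j$, $L(js)=\sum_{n\ge1}a(n)n^{-js}$. *)

theory Defs
  imports "HOL-Analysis.Analysis" "HOL-Computational_Algebra.Primes"
begin

text \<open>
  Sums are taken with \<^const>\<open>infsum\<close>, whose value is 0 where the family is not summable.
  In the complex plane this summability is the same as absolute convergence, so the two
  series below have their intended values exactly where they converge absolutely.
\<close>

definition dirichlet_series :: "(nat \<Rightarrow> complex) \<Rightarrow> complex \<Rightarrow> complex" where
  "dirichlet_series a s = (\<Sum>\<^sub>\<infinity>n\<in>{1..}. a n / of_nat n powr s)"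

text \<open>
  The double series is summed over the pairs \<open>(p, k)\<close>. Only the values of \<open>b\<close> at prime
  powers matter.
\<close>

definition prime_power_series :: "(nat \<Rightarrow> complex) \<Rightarrow> complex \<Rightarrow> complex" where
  "prime_power_series b s =
     (\<Sum>\<^sub>\<infinity>(p, k)\<in>{p. prime p} \<times> {1..}. b (p ^ k) / of_nat p powr (of_nat k * s))"

definition zeros_right_of_1 :: "(complex \<Rightarrow> complex) \<Rightarrow> complex set" where
  "zeros_right_of_1 f = {s. Re s > 1 \<and> f s = 0}"

end

theory Submission
  imports Defs "HOL-Complex_Analysis.Complex_Analysis"
begin

text \<open>
  Write \<open>F(s)\<close> for \<open>L(s) + L(2s) + \<dots> + L(Ns)\<close>. By Kronecker's theorem the numbers
  \<open>p powr (-i\<tau>)\<close>, for finitely many primes \<open>p\<close> at a time, come arbitrarily close to any prescribed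
  unimodular numbers \<open>z\<^sub>p\<close>, and they do so for arbitrarily large \<open>\<tau>\<close>. Hence \<open>F(s + i\<tau>)\<close> approaches the
  twisted function \<open>F\<^sub>z(s)\<close>, in which every \<open>p powr (-s)\<close> is replaced by \<open>z\<^sub>p p powr (-s)\<close>. By
  Hurwitz's theorem a single zero of a single \<open>F\<^sub>z\<close> forces \<open>F\<close> to vanish at arbitrarily large
  heights (\<open>infinitely_many_zeros_of_twisted_zero\<close>). The freedom in \<open>z\<close> makes such a zero easy
  to find, already on the real axis.

  For real \<open>\<sigma> > 1\<close> let \<open>\<Lambda>(z)\<close> be the twist of \<open>log L(\<sigma>)\<close>, so that \<open>F\<^sub>z(\<sigma>) = exp (\<Lambda>(z)) + r(z)\<close>,
  where \<open>r(z)\<close> collects the terms with \<open>j \<ge> 2\<close>. Suppose that \<open>r\<close> has a continuous logarithm \<open>l\<close>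
  which is bounded independently of \<open>\<sigma>\<close>. Then it is enough to solve \<open>\<Lambda>(z) = l(z) + \<pi>i\<close>. As
  \<open>\<theta> < 1/2\<close>, the prime powers \<open>p\<^sup>k\<close> with \<open>k \<ge> 2\<close> contribute a bounded amount to \<open>\<Lambda>\<close>, and the rest is
  the sum of \<open>b(p) z\<^sub>p p powr (-\<sigma>)\<close>. Its terms are bounded, while the sum of their absolute values tends
  to infinity as \<open>\<sigma> \<rightarrow> 1\<close>, because \<open>b(p) = a(p)\<close>. So for \<open>\<sigma>\<close> close to 1 there is a
  continuous choice of \<open>z = z(w)\<close>, for \<open>w\<close> in a large disc, that makes this sum equal to \<open>w\<close> up to a bounded
  error (\<open>unimodular_sums_cover_disc\<close>). The map \<open>w \<mapsto> w - \<Lambda>(z(w)) + l(z(w)) + \<pi>i\<close> then sends the disc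
  into itself, and a fixed point given by Brouwer's theorem solves the equation
  (\<open>twisted_zero_exists\<close>).

  The logarithm \<open>l\<close> is obvious for \<open>N = 2\<close>, where \<open>r\<close> is a single exponential. In the other cases
  \<open>l\<close> is the principal logarithm of \<open>r\<close>, and one needs a positive lower bound for the real part of
  \<open>r\<close>. For large \<open>N\<close> it exists because the twists of \<open>L(j\<sigma>)\<close> tend to 1 as \<open>j\<close> grows, uniformly in
  \<open>\<sigma>\<close> and \<open>z\<close> (\<open>twisted_tail_Re_pos_eventually\<close>). If \<open>\<bar>a(n)\<bar> \<le> n powr (1/4)\<close>, then for every \<open>j \<ge> 2\<close> these
  twists differ from 1 by at most \<open>\<zeta>(7/4) - 1 < 1\<close> (\<open>norm_dirichlet_series_minus_1_le\<close>).
\<close>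

section \<open>Dominated convergence for unordered sums\<close>

lemma tendsto_infsum_dominated:
  fixes f :: "'i \<Rightarrow> 'x \<Rightarrow> 'b::banach"
  assumes lim: "\<And>i. i \<in> I \<Longrightarrow> (f i \<longlongrightarrow> l i) F"
    and bound: "\<forall>\<^sub>F x in F. \<forall>i\<in>I. norm (f i x) \<le> g i"
    and g: "g summable_on I"
  shows "((\<lambda>x. \<Sum>\<^sub>\<infinity>i\<in>I. f i x) \<longlongrightarrow> (\<Sum>\<^sub>\<infinity>i\<in>I. l i)) F"
proof (cases "F = bot")
  case False
  define Y where "Y = {x. \<forall>i\<in>I. norm (f i x) \<le> g i}"
  have ul: "uniform_limit Y (\<lambda>X x. \<Sum>i\<in>X. f i x) (\<lambda>x. \<Sum>\<^sub>\<infinity>i\<in>I. f i x) (finite_subsets_at_top I)"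
    by (rule Weierstrass_m_test_general[OF _ g]) (auto simp: Y_def)
  have l: "norm (l i) \<le> g i" if "i \<in> I" for i
    by (rule tendsto_upperbound[OF tendsto_norm[OF lim[OF that]] _ False])
       (use bound in eventually_elim, use that in auto)
  have "(\<lambda>i. norm (l i)) summable_on I"
    by (rule summable_on_comparison_test[OF g]) (use l in auto)
  hence lsum: "l summable_on I"
    by (rule abs_summable_summable)
  show ?thesis
  proof (rule swap_uniform_limit'[OF _ infsum_tendsto[OF lsum] ul])
    show "\<forall>\<^sub>F X in finite_subsets_at_top I. ((\<lambda>x. \<Sum>i\<in>X. f i x) \<longlongrightarrow> sum l X) F"
      by (intro eventually_finite_subsets_at_top_weakI tendsto_sum lim) auto
    show "\<forall>\<^sub>F x in F. x \<in> Y"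
      using bound by (simp add: Y_def)
  qed auto
qed auto

section \<open>Kronecker's theorem for the primes\<close>

text \<open>
  A vanishing integer combination of logarithms is an equality of two products of prime
  powers, with the positive coefficients as exponents on one side and the negative ones on
  the other. Unique factorization decides.
\<close>
lemma ln_primes_linearly_independent:
  fixes c :: "nat \<Rightarrow> int"
  assumes fin: "finite P" and P: "\<And>p. p \<in> P \<Longrightarrow> prime p"
    and sum0: "(\<Sum>p\<in>P. of_int (c p) * ln (real p)) = 0" and q: "q \<in> P"
  shows "c q = 0"
proof -
  define x y where "x = (\<Prod>p\<in>P. p ^ nat (c p))" and "y = (\<Prod>p\<in>P. p ^ nat (- c p))"
  have pos: "p > 0" if "p \<in> P" for p
    using P[OF that] prime_gt_0_nat by blast
  have xy: "x > 0" "y > 0"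
    using pos by (auto simp: x_def y_def intro!: prod_pos)
  have ln_prod': "ln (real (\<Prod>p\<in>P. p ^ f p)) = (\<Sum>p\<in>P. real (f p) * ln (real p))" for f
    using pos fin by (auto simp: ln_prod ln_realpow intro!: sum.cong)
  have "ln (real x) - ln (real y) = (\<Sum>p\<in>P. (real (nat (c p)) - real (nat (- c p))) * ln (real p))"
    unfolding x_def y_def ln_prod' by (simp add: sum_subtractf left_diff_distrib)
  also have "\<dots> = (\<Sum>p\<in>P. of_int (c p) * ln (real p))"
    by (intro sum.cong refl arg_cong2[where f = "(*)"]) linarith
  finally have "ln (real x) = ln (real y)"
    using sum0 by simp
  hence "x = y"
    using xy by simp
  hence "multiplicity q x = multiplicity q y"
    by simp
  hence "nat (c q) = nat (- c q)"
    using fin P q by (simp add: x_def y_def multiplicity_prod_prime_powers)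
  thus ?thesis
    by linarith
qed

lemma norm_cis_minus_1_le: "norm (cis x - 1) \<le> \<bar>x\<bar>"
  using dist_exp_i_1[of x] abs_sin_x_le_abs_x[of "x / 2"] by (simp add: cis_conv_exp norm_minus_commute)

text \<open>
  Kronecker's theorem gives some real \<open>t\<close> with the required approximation, but says nothing about its
  size. Dirichlet's simultaneous approximation theorem gives arbitrarily large near-periods
  of all the \<open>p powr (-i\<tau>)\<close> at once; adding one of them to \<open>t\<close> moves it beyond \<open>T\<close>.
\<close>
lemma imaginary_powers_of_primes_approximate:
  fixes z :: "nat \<Rightarrow> complex"
  assumes fin: "finite P" and P: "\<And>p. p \<in> P \<Longrightarrow> prime p"
    and z: "\<And>p. p \<in> P \<Longrightarrow> norm (z p) = 1" and \<epsilon>: "\<epsilon> > 0"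
  shows "\<exists>\<tau>\<ge>T. \<forall>p\<in>P. norm (of_nat p powr (- (\<i> * of_real \<tau>)) - z p) < \<epsilon>"
proof -
  obtain g :: "nat \<Rightarrow> nat" and n where g: "bij_betw g {..<n} P"
    using ex_bij_betw_nat_finite[OF fin] by (metis atLeast0LessThan)
  define \<theta> where "\<theta> i = ln (real (g i)) / (2 * pi)" for i
  define \<alpha> where "\<alpha> i = - Arg (z (g i)) / (2 * pi)" for i
  \<comment> \<open>Kronecker's and Dirichlet's theorems each cost an error \<open>\<delta>\<close> in the phase, measured in full turns.\<close>
  define \<delta> where "\<delta> = \<epsilon> / (4 * pi)"
  have gP: "g i \<in> P" if "i < n" for i
    using g that by (auto simp: bij_betw_def)
  have gpos: "g i > 0" if "i < n" for i
    using P[OF gP[OF that]] prime_gt_0_nat by blast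
  have inj\<theta>: "inj_on \<theta> {..<n}"
  proof (rule inj_onI)
    fix i j assume ij: "i \<in> {..<n}" "j \<in> {..<n}" "\<theta> i = \<theta> j"
    hence "g i = g j"
      using gpos[of i] gpos[of j] by (simp add: \<theta>_def)
    thus "i = j"
      using g ij by (auto simp: bij_betw_def inj_on_def)
  qed
  interpret Modules.module "(\<lambda>r. (*) (real_of_int r))"
    by (simp add: Modules.module.intro distrib_left mult.commute)
  have indep: "independent (\<theta> ` {..<n})"
  proof
    assume "dependent (\<theta> ` {..<n})"
    then obtain u v where u: "(\<Sum>v\<in>\<theta> ` {..<n}. of_int (u v) * v) = 0" "v \<in> \<theta> ` {..<n}" "u v \<noteq> 0"
      using dependent_finite[of "\<theta> ` {..<n}"] by auto
    define c where "c p = u (ln (real p) / (2 * pi))" for p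
    have "(\<Sum>p\<in>P. of_int (c p) * ln (real p)) = (\<Sum>i<n. of_int (c (g i)) * ln (real (g i)))"
      by (rule sum.reindex_bij_betw[OF g, symmetric])
    also have "\<dots> = (\<Sum>i<n. of_int (u (\<theta> i)) * \<theta> i) * (2 * pi)"
      by (simp add: c_def \<theta>_def sum_distrib_right)
    also have "(\<Sum>i<n. of_int (u (\<theta> i)) * \<theta> i) = 0"
      using u(1) by (simp add: sum.reindex[OF inj\<theta>])
    finally have sum0: "(\<Sum>p\<in>P. of_int (c p) * ln (real p)) = 0"
      by simp
    obtain i where i: "i < n" "v = \<theta> i"
      using u(2) by auto
    have "c (g i) = 0"
      using ln_primes_linearly_independent[OF fin P sum0 gP[OF i(1)]] .
    thus False
      using u(3) i by (simp add: c_def \<theta>_def)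
  qed
  have \<delta>: "\<delta> > 0"
    using \<epsilon> by (simp add: \<delta>_def)
  obtain t h where th: "\<And>i. i < n \<Longrightarrow> \<bar>t * \<theta> i - of_int (h i) - \<alpha> i\<bar> < \<delta>"
    using Kronecker_thm_1[OF indep inj\<theta> \<delta>, of \<alpha>] by metis
  define M where "M = max 1 (T + \<bar>t\<bar>)"
  obtain N :: nat where N: "N > 0" "1 / N < \<delta>"
    by (metis \<delta> gr_zeroI inverse_eq_divide real_arch_inverse)
  obtain q p where qp: "0 < q" "\<And>i. i < n \<Longrightarrow> \<bar>of_int q * (M * \<theta> i) - of_int (p i)\<bar> < 1 / N"
    using Dirichlet_approx_simult[OF N(1), of n "\<lambda>i. M * \<theta> i"] by metis
  define \<tau> where "\<tau> = t + of_int q * M"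
  have "of_int q * M \<ge> 1 * M"
    using qp(1) by (intro mult_right_mono) (auto simp: M_def)
  hence "\<tau> \<ge> T"
    by (auto simp: \<tau>_def M_def)
  moreover have "norm (of_nat p' powr (- (\<i> * of_real \<tau>)) - z p') < \<epsilon>" if p': "p' \<in> P" for p'
  proof -
    obtain i where i: "i < n" "p' = g i"
      using p' g by (auto simp: bij_betw_def)
    define e where "e = \<tau> * \<theta> i - of_int (h i + p i) - \<alpha> i"
    have "\<bar>e\<bar> < 2 * \<delta>"
      using th[OF i(1)] qp(2)[OF i(1)] N(2) by (simp add: e_def \<tau>_def algebra_simps)
    have "- (\<tau> * ln (real p')) = - 2 * pi * e + Arg (z p') + 2 * pi * of_int (- h i - p i)"
      by (simp add: e_def \<alpha>_def \<theta>_def i field_simps)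
    hence "cis (- (\<tau> * ln (real p'))) = cis (- 2 * pi * e) * cis (Arg (z p')) * cis (2 * pi * of_int (- h i - p i))"
      by (simp only: cis_mult)
    also have "cis (2 * pi * of_int (- h i - p i)) = 1"
      by (rule cis_multiple_2pi) auto
    also have "cis (Arg (z p')) = z p'"
      using z[OF p'] by (metis Arg_zero cis_Arg norm_zero sgn_div_norm scaleR_one inverse_1 zero_neq_one)
    finally have eq: "cis (- (\<tau> * ln (real p'))) = cis (- 2 * pi * e) * z p'"
      by simp
    have "of_nat p' powr (- (\<i> * of_real \<tau>)) = cis (- (\<tau> * ln (real p')))"
      using gpos[OF i(1)] i(2) by (simp add: powr_def cis_conv_exp mult_ac flip: Ln_of_nat)
    also have "norm (\<dots> - z p') = norm ((cis (- 2 * pi * e) - 1) * z p')"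
      by (simp add: eq algebra_simps)
    also have "\<dots> \<le> \<bar>- 2 * pi * e\<bar>"
      using norm_cis_minus_1_le[of "- 2 * pi * e"] z[OF p'] by (simp add: norm_mult)
    also have "\<dots> < \<epsilon>"
      using \<open>\<bar>e\<bar> < 2 * \<delta>\<close> by (simp add: \<delta>_def abs_mult field_simps)
    finally show ?thesis .
  qed
  ultimately show ?thesis
    by blast
qed

lemma vertical_shifts_approach_any_twist:
  fixes z :: "nat \<Rightarrow> complex"
  assumes z: "\<And>p. norm (z p) = 1"
  obtains \<tau> :: "nat \<Rightarrow> real" where "\<And>m. \<tau> m \<ge> real m"
    and "\<And>p. prime p \<Longrightarrow> (\<lambda>m. of_nat p powr (- (\<i> * of_real (\<tau> m)))) \<longlonglongrightarrow> z p"
proof -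
  have "\<exists>\<tau>\<ge>real m. \<forall>p\<in>{p. prime p \<and> p \<le> m}. norm (of_nat p powr (- (\<i> * of_real \<tau>)) - z p) < 1 / real (Suc m)" for m
    by (rule imaginary_powers_of_primes_approximate) (auto simp: z)
  then obtain \<tau> where \<tau>: "\<And>m. \<tau> m \<ge> real m"
      "\<And>m p. prime p \<Longrightarrow> p \<le> m \<Longrightarrow> norm (of_nat p powr (- (\<i> * of_real (\<tau> m))) - z p) < 1 / real (Suc m)"
    by (metis (mono_tags, lifting) mem_Collect_eq)
  have "(\<lambda>m. of_nat p powr (- (\<i> * of_real (\<tau> m)))) \<longlonglongrightarrow> z p" if p: "prime p" for p
  proof -
    have "(\<lambda>m. of_nat p powr (- (\<i> * of_real (\<tau> m))) - z p) \<longlonglongrightarrow> 0"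
    proof (rule Lim_null_comparison)
      show "\<forall>\<^sub>F m in sequentially. norm (of_nat p powr (- (\<i> * of_real (\<tau> m))) - z p) \<le> 1 / real (Suc m)"
        using eventually_ge_at_top[of p] by eventually_elim (use \<tau>(2)[OF p] in \<open>auto intro: less_imp_le\<close>)
      show "(\<lambda>m. 1 / real (Suc m)) \<longlonglongrightarrow> 0"
        using LIMSEQ_inverse_real_of_nat by (simp add: inverse_eq_divide)
    qed
    thus ?thesis
      by (simp add: Lim_null[symmetric])
  qed
  with \<tau>(1) show ?thesis
    using that by blast
qed

section \<open>Covering a disc by sums of vectors of given lengths\<close>

text \<open>
  Choose each new sign opposite to the sign of the partial sum.
\<close>
lemma balanced_signs:
  fixes r :: "'a \<Rightarrow> real"
  assumes "finite A" "\<And>p. p \<in> A \<Longrightarrow> 0 \<le> r p \<and> r p \<le> K" "0 \<le> K"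
  shows "\<exists>e::'a \<Rightarrow> real. (\<forall>p. e p = 1 \<or> e p = -1) \<and> \<bar>\<Sum>p\<in>A. e p * r p\<bar> \<le> K"
  using assms
proof (induction A rule: finite_induct)
  case (insert q A)
  then obtain e :: "'a \<Rightarrow> real" where e: "\<forall>p. e p = 1 \<or> e p = -1" "\<bar>\<Sum>p\<in>A. e p * r p\<bar> \<le> K"
    by auto
  define s where "s = (\<Sum>p\<in>A. e p * r p)"
  define e' where "e' = e(q := if s \<ge> 0 then -1 else 1)"
  have "(\<Sum>p\<in>A. e' p * r p) = s"
    unfolding s_def using insert by (intro sum.cong) (auto simp: e'_def)
  hence "(\<Sum>p\<in>insert q A. e' p * r p) = e' q * r q + s"
    using insert by simp
  moreover have "\<bar>e' q * r q + s\<bar> \<le> K"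
    using insert.prems(1)[of q] e(2) by (auto simp: e'_def s_def[symmetric])
  ultimately show ?case
    using e(1) by (intro exI[of _ e']) (auto simp: e'_def)
next
  case empty
  show ?case
    by (rule exI[of _ "\<lambda>_. 1"]) (simp add: empty)
qed

text \<open>
  Rotate all \<open>c p\<close> to the positive real axis and split \<open>A\<close> into two parts \<open>X\<close> and \<open>Y\<close> whose lengths have
  nearly equal sums \<open>SX\<close> and \<open>SY\<close>. Turn the vectors of \<open>X\<close> by angles \<open>\<plusminus>\<alpha>\<close>: the real parts add up to \<open>SX cos \<alpha>\<close>, which takes
  every value in \<open>[-SX, SX]\<close>, and with balanced signs the imaginary parts cancel
  up to \<open>K\<close>. The part \<open>Y\<close>, turned by a further right angle, does the same for the imaginary
  axis. As \<open>\<alpha>\<close> is an arccosine, everything depends continuously on the target \<open>w\<close>, which is what Brouwer's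
  theorem will require. An exact representation of \<open>w\<close> is harder to choose continuously, and a
  bounded error is harmless.
\<close>
lemma unimodular_sums_cover_disc:
  fixes c :: "'a \<Rightarrow> complex"
  assumes fin: "finite A" and c: "\<And>p. p \<in> A \<Longrightarrow> norm (c p) \<le> K" and K: "0 \<le> K" and R: "R > 0"
    and large: "(\<Sum>p\<in>A. norm (c p)) \<ge> 2 * R + K"
  shows "\<exists>Z :: complex \<Rightarrow> 'a \<Rightarrow> complex. (\<forall>w p. norm (Z w p) = 1) \<and>
    (\<forall>p. continuous_on (cball 0 R) (\<lambda>w. Z w p)) \<and>
    (\<forall>w\<in>cball 0 R. norm ((\<Sum>p\<in>A. c p * Z w p) - w) \<le> 2 * K)"
proof -
  define r where "r p = norm (c p)" for p
  have r: "0 \<le> r p \<and> r p \<le> K" if "p \<in> A" for p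
    using c[OF that] by (simp add: r_def)
  obtain e :: "'a \<Rightarrow> real" where
      "(\<forall>p. e p = 1 \<or> e p = -1) \<and> \<bar>\<Sum>p\<in>A. e p * r p\<bar> \<le> K"
    using balanced_signs[OF fin r K] by (rule exE)
  hence e: "e p = 1 \<or> e p = -1" "\<bar>\<Sum>p\<in>A. e p * r p\<bar> \<le> K" for p
    by simp_all
  define X Y where "X = {p \<in> A. e p = 1}" and "Y = {p \<in> A. e p = -1}"
  have XY: "A = X \<union> Y" "X \<inter> Y = {}" and finXY: "finite X" "finite Y"
    using e(1) fin by (auto simp: X_def Y_def)
  have split: "sum f A = sum f X + sum f Y" for f :: "'a \<Rightarrow> 'b::comm_monoid_add"
    unfolding XY(1) by (rule sum.union_disjoint) (use finXY XY in auto)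
  define SX SY where "SX = sum r X" and "SY = sum r Y"
  have "(\<Sum>p\<in>A. e p * r p) = SX - SY"
    unfolding split SX_def SY_def by (simp add: X_def Y_def sum_negf)
  moreover have "SX + SY \<ge> 2 * R + K"
    using large unfolding split SX_def SY_def r_def .
  ultimately have S: "SX \<ge> R" "SY \<ge> R"
    using e(2) by auto
  have rX: "0 \<le> r p \<and> r p \<le> K" if "p \<in> X" for p
    using r that by (simp add: X_def)
  obtain f :: "'a \<Rightarrow> real" where
      "(\<forall>p. f p = 1 \<or> f p = -1) \<and> \<bar>\<Sum>p\<in>X. f p * r p\<bar> \<le> K"
    using balanced_signs[OF finXY(1) rX K] by (rule exE)
  hence f: "f p = 1 \<or> f p = -1" "\<bar>\<Sum>p\<in>X. f p * r p\<bar> \<le> K" for p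
    by simp_all
  have rY: "0 \<le> r p \<and> r p \<le> K" if "p \<in> Y" for p
    using r that by (simp add: Y_def)
  obtain g :: "'a \<Rightarrow> real" where
      "(\<forall>p. g p = 1 \<or> g p = -1) \<and> \<bar>\<Sum>p\<in>Y. g p * r p\<bar> \<le> K"
    using balanced_signs[OF finXY(2) rY K] by (rule exE)
  hence g: "g p = 1 \<or> g p = -1" "\<bar>\<Sum>p\<in>Y. g p * r p\<bar> \<le> K" for p
    by simp_all
  define u where "u p = (if c p = 0 then 1 else cnj (sgn (c p)))" for p
  have u: "norm (u p) = 1" "c p * u p = of_real (r p)" for p
  proof -
    show "norm (u p) = 1"
      by (simp add: u_def norm_sgn)
    have "c p * cnj (sgn (c p)) = (c p * cnj (c p)) / of_real (norm (c p))"
      by (simp add: sgn_eq)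
    also have "\<dots> = of_real ((norm (c p))\<^sup>2) / of_real (norm (c p))"
      using complex_norm_square[of "c p"] by simp
    finally show "c p * u p = of_real (r p)"
      by (simp add: u_def r_def power2_eq_square)
  qed
  define \<alpha> where "\<alpha> w = arccos (Re w / SX)" for w
  define \<beta> where "\<beta> w = arccos (Im w / SY)" for w
  define Z where "Z = (\<lambda>w p. if p \<in> X then u p * cis (f p * \<alpha> w)
      else if p \<in> Y then u p * (\<i> * cis (g p * \<beta> w)) else 1)"
  have bnd: "\<bar>Re w / SX\<bar> \<le> 1" "\<bar>Im w / SY\<bar> \<le> 1" if "w \<in> cball 0 R" for w
    using that S R abs_Re_le_cmod[of w] abs_Im_le_cmod[of w] by (auto simp: abs_divide)
  have bnd': "-1 \<le> Re w / SX" "Re w / SX \<le> 1" "-1 \<le> Im w / SY" "Im w / SY \<le> 1" if "w \<in> cball 0 R" for w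
    using bnd[OF that] by (simp_all only: abs_le_iff minus_le_iff)
  have "continuous_on (cball 0 R) (\<lambda>w. Re w / SX)" "continuous_on (cball 0 R) (\<lambda>w. Im w / SY)"
    using S R by (auto intro!: continuous_intros)
  from this[THEN continuous_on_arccos]
  have cont: "continuous_on (cball 0 R) \<alpha>" "continuous_on (cball 0 R) \<beta>"
    unfolding \<alpha>_def \<beta>_def using bnd' by blast+
  have cis_sign: "cis (s * x) = of_real (cos x) + \<i> * of_real (s * sin x)" if "s = 1 \<or> s = -1" for s x
    using that by (auto simp: complex_eq_iff)
  show ?thesis
  proof (intro exI[of _ Z] conjI allI ballI)
    show "norm (Z w p) = 1" for w p
      by (simp add: Z_def norm_mult u)
    show "continuous_on (cball 0 R) (\<lambda>w. Z w p)" for p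
    proof -
      have "continuous_on (cball 0 R) (\<lambda>w. u p * cis (f p * \<alpha> w))"
           "continuous_on (cball 0 R) (\<lambda>w. u p * (\<i> * cis (g p * \<beta> w)))"
        using cont by (auto intro!: continuous_intros)
      thus ?thesis
        by (cases "p \<in> X"; cases "p \<in> Y") (simp_all add: Z_def)
    qed
    fix w :: complex assume w: "w \<in> cball 0 R"
    have cosw: "SX * cos (\<alpha> w) = Re w" "SY * cos (\<beta> w) = Im w"
      using bnd[OF w] S R by (auto simp: \<alpha>_def \<beta>_def cos_arccos_abs)
    have "(\<Sum>p\<in>X. c p * Z w p) = (\<Sum>p\<in>X. of_real (r p * cos (\<alpha> w)) + \<i> * of_real (f p * r p * sin (\<alpha> w)))"
    proof (intro sum.cong refl)
      fix p assume "p \<in> X"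
      hence "c p * Z w p = c p * u p * cis (f p * \<alpha> w)"
        by (simp add: Z_def)
      also have "\<dots> = of_real (r p) * cis (f p * \<alpha> w)"
        by (simp only: u)
      finally show "c p * Z w p = of_real (r p * cos (\<alpha> w)) + \<i> * of_real (f p * r p * sin (\<alpha> w))"
        unfolding cis_sign[OF f(1)] by (simp add: algebra_simps)
    qed
    also have "\<dots> = of_real (SX * cos (\<alpha> w)) + \<i> * of_real ((\<Sum>p\<in>X. f p * r p) * sin (\<alpha> w))"
      by (simp add: sum.distrib SX_def sum_distrib_right sum_distrib_left)
    finally have sX: "(\<Sum>p\<in>X. c p * Z w p) = of_real (Re w) + \<i> * of_real ((\<Sum>p\<in>X. f p * r p) * sin (\<alpha> w))"
      unfolding cosw .
    have "(\<Sum>p\<in>Y. c p * Z w p) = (\<Sum>p\<in>Y. \<i> * of_real (r p * cos (\<beta> w)) - of_real (g p * r p * sin (\<beta> w)))"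
    proof (intro sum.cong refl)
      fix p assume "p \<in> Y"
      hence "c p * Z w p = c p * u p * (\<i> * cis (g p * \<beta> w))"
        using XY by (auto simp: Z_def)
      also have "\<dots> = of_real (r p) * (\<i> * cis (g p * \<beta> w))"
        by (simp only: u)
      finally show "c p * Z w p = \<i> * of_real (r p * cos (\<beta> w)) - of_real (g p * r p * sin (\<beta> w))"
        unfolding cis_sign[OF g(1)] by (simp add: algebra_simps)
    qed
    also have "\<dots> = \<i> * of_real (SY * cos (\<beta> w)) - of_real ((\<Sum>p\<in>Y. g p * r p) * sin (\<beta> w))"
      by (simp add: sum_subtractf SY_def sum_distrib_right sum_distrib_left)
    finally have sY: "(\<Sum>p\<in>Y. c p * Z w p) = \<i> * of_real (Im w) - of_real ((\<Sum>p\<in>Y. g p * r p) * sin (\<beta> w))"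
      unfolding cosw .
    have "(\<Sum>p\<in>A. c p * Z w p) - w = \<i> * of_real ((\<Sum>p\<in>X. f p * r p) * sin (\<alpha> w))
        - of_real ((\<Sum>p\<in>Y. g p * r p) * sin (\<beta> w))"
      unfolding split sX sY by (simp add: complex_eq_iff)
    also have "norm \<dots> \<le> \<bar>(\<Sum>p\<in>X. f p * r p) * sin (\<alpha> w)\<bar> + \<bar>(\<Sum>p\<in>Y. g p * r p) * sin (\<beta> w)\<bar>"
      by (rule order_trans[OF norm_triangle_ineq4]) (simp only: norm_mult norm_ii norm_of_real mult_1 abs_mult order_refl)
    also have "\<dots> \<le> K * 1 + K * 1"
      unfolding abs_mult by (intro add_mono mult_mono f(2) g(2)) (auto simp: K)
    finally show "norm ((\<Sum>p\<in>A. c p * Z w p) - w) \<le> 2 * K"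
      by simp
  qed
qed

section \<open>Dirichlet coefficients of an exponential\<close>
lemma has_sum_product_abs:
  fixes f :: "'i \<Rightarrow> 'a :: {real_normed_field, banach}" and g :: "'j \<Rightarrow> 'a"
  assumes f: "(f has_sum S) A" and f': "(\<lambda>x. norm (f x)) summable_on A"
    and g: "(g has_sum T) B" and g': "(\<lambda>y. norm (g y)) summable_on B"
  shows "((\<lambda>z. f (fst z) * g (snd z)) has_sum (S * T)) (A \<times> B)"
    and "(\<lambda>z. norm (f (fst z) * g (snd z))) summable_on (A \<times> B)"
proof -
  show sm: "(\<lambda>z. norm (f (fst z) * g (snd z))) summable_on (A \<times> B)"
  proof (rule summable_on_SigmaI)
    show "((\<lambda>y. norm (f (fst (x, y)) * g (snd (x, y)))) has_sum norm (f x) * (\<Sum>\<^sub>\<infinity>y\<in>B. norm (g y))) B" for x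
      using has_sum_cmult_right[OF has_sum_infsum[OF g'], of "norm (f x)"] by (simp add: norm_mult)
    show "(\<lambda>x. norm (f x) * (\<Sum>\<^sub>\<infinity>y\<in>B. norm (g y))) summable_on A"
      by (rule summable_on_cmult_left[OF f'])
  qed simp
  show "((\<lambda>z. f (fst z) * g (snd z)) has_sum (S * T)) (A \<times> B)"
  proof (rule has_sum_SigmaI)
    show "((\<lambda>y. f (fst (x, y)) * g (snd (x, y))) has_sum f x * T) B" for x
      using has_sum_cmult_right[OF g, of "f x"] by simp
    show "((\<lambda>x. f x * T) has_sum S * T) A"
      by (rule has_sum_cmult_left[OF f])
    show "(\<lambda>z. f (fst z) * g (snd z)) summable_on A \<times> B"
      by (rule abs_summable_summable[OF sm])
  qed
qed

text \<open>
  Expanding the \<open>n\<close>-th power of a sum gives one product for each list of \<open>n\<close> indices.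
\<close>
lemma has_sum_power_lists:
  fixes f :: "'i \<Rightarrow> 'a :: {real_normed_field, banach}"
  assumes f: "(\<lambda>i. norm (f i)) summable_on I"
  shows "((\<lambda>l. prod_list (map f l)) has_sum (\<Sum>\<^sub>\<infinity>i\<in>I. f i) ^ n) {l \<in> lists I. length l = n} \<and>
         (\<lambda>l. norm (prod_list (map f l))) summable_on {l \<in> lists I. length l = n}"
proof (induction n)
  case 0
  have "{l \<in> lists I. length l = 0} = {[]}"
    by auto
  thus ?case
    by (simp add: has_sum_finite_iff)
next
  case (Suc n)
  define h where "h = (\<lambda>(x::'i, l). x # l)"
  have eq: "{l \<in> lists I. length l = Suc n} = h ` (I \<times> {l \<in> lists I. length l = n})"
    by (auto simp: h_def image_iff length_Suc_conv)
  have inj: "inj_on h X" for X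
    by (auto simp: inj_on_def h_def)
  have fI: "(f has_sum (\<Sum>\<^sub>\<infinity>i\<in>I. f i)) I"
    by (rule has_sum_infsum[OF abs_summable_summable[OF f]])
  note prod = has_sum_product_abs[OF fI f conjunct1[OF Suc.IH] conjunct2[OF Suc.IH]]
  show ?case
    unfolding eq has_sum_reindex[OF inj] summable_on_reindex[OF inj]
    using prod by (simp add: h_def o_def case_prod_unfold)
qed

text \<open>
  Collecting the powers in the exponential series, \<open>exp\<close> of a sum becomes a sum over all finite
  lists of indices. If the indices carry integers, the lists can then be sorted by the product of
  these, which gives a Dirichlet series.
\<close>
lemma has_sum_exp_lists:
  fixes f :: "'i \<Rightarrow> complex"
  assumes f: "(\<lambda>i. norm (f i)) summable_on I"
  shows "((\<lambda>l. prod_list (map f l) / fact (length l)) has_sum exp (\<Sum>\<^sub>\<infinity>i\<in>I. f i)) (lists I)"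
    and "(\<lambda>l. norm (prod_list (map f l) / fact (length l))) summable_on lists I"
proof -
  define S where "S = (\<Sum>\<^sub>\<infinity>i\<in>I. f i)"
  define T where "T = (\<Sum>\<^sub>\<infinity>i\<in>I. norm (f i))"
  define w where "w = (\<lambda>l. prod_list (map f l) / fact (length l))"
  define Ln where "Ln n = {l \<in> lists I. length l = n}" for n
  have bij: "bij_betw snd (Sigma (UNIV :: nat set) Ln) (lists I)"
    by (rule bij_betwI[where g = "\<lambda>l. (length l, l)"]) (auto simp: Ln_def)
  have 1: "((\<lambda>l. w (snd (n, l))) has_sum S ^ n / fact n) (Ln n)" for n
  proof -
    have "((\<lambda>l. prod_list (map f l) * inverse (fact n)) has_sum S ^ n * inverse (fact n)) (Ln n)"
      using conjunct1[OF has_sum_power_lists[OF f, of n]] unfolding S_def Ln_def by (rule has_sum_cmult_left)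
    moreover have "w (snd (n, l)) = prod_list (map f l) * inverse (fact n)" if "l \<in> Ln n" for l
      using that by (simp add: w_def Ln_def divide_inverse)
    ultimately show ?thesis
      unfolding divide_inverse by (simp only: cong: has_sum_cong)
  qed
  have 2: "((\<lambda>l. norm (w (snd (n, l)))) has_sum T ^ n / fact n) (Ln n)" for n
  proof -
    have "((\<lambda>l. prod_list (map (\<lambda>i. norm (f i)) l) * inverse (fact n)) has_sum T ^ n * inverse (fact n)) (Ln n)"
      using conjunct1[OF has_sum_power_lists[of "\<lambda>i. norm (f i)" I n]] f unfolding T_def Ln_def
      by (intro has_sum_cmult_left) simp
    moreover have "norm (w l) = prod_list (map (\<lambda>i. norm (f i)) l) * inverse (fact n)" if "l \<in> Ln n" for l
    proof -
      have "norm (prod_list (map f l)) = prod_list (map (\<lambda>i. norm (f i)) l)" for l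
        by (induction l) (auto simp: norm_mult)
      thus ?thesis
        using that by (simp add: w_def Ln_def norm_mult divide_inverse norm_inverse)
    qed
    ultimately show ?thesis
      unfolding divide_inverse by (simp only: snd_conv cong: has_sum_cong)
  qed
  have exp_sums: "(\<lambda>n. x ^ n / fact n) sums exp x" for x :: "'b :: {real_normed_field, banach}"
    using exp_converges[of x] by (simp add: scaleR_conv_of_real field_simps)
  have "(\<lambda>x. norm (w (snd x))) summable_on (Sigma UNIV Ln)"
  proof (rule summable_on_SigmaI[OF 2])
    have "T \<ge> 0"
      unfolding T_def by (rule infsum_nonneg) auto
    thus "(\<lambda>n. T ^ n / fact n) summable_on UNIV"
      using exp_sums[of T] by (intro summable_nonneg_imp_summable_on) (auto simp: sums_iff)
  qed auto
  hence sm: "(\<lambda>l. norm (w l)) summable_on lists I"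
    by (simp add: summable_on_reindex_bij_betw[OF bij, of "\<lambda>l. norm (w l)"])
  thus "(\<lambda>l. norm (prod_list (map f l) / fact (length l))) summable_on lists I"
    by (simp add: w_def)
  have "((\<lambda>x. w (snd x)) has_sum exp S) (Sigma UNIV Ln)"
  proof (rule has_sum_SigmaI[OF 1])
    have "summable (\<lambda>n. norm (S ^ n / fact n))"
      using exp_sums[of "norm S"] by (simp add: norm_divide norm_power sums_iff)
    thus "((\<lambda>n. S ^ n / fact n) has_sum exp S) UNIV"
      using exp_sums by (rule norm_summable_imp_has_sum)
    have "w summable_on lists I"
      by (rule abs_summable_summable[OF sm])
    thus "(\<lambda>x. w (snd x)) summable_on Sigma UNIV Ln"
      by (simp add: summable_on_reindex_bij_betw[OF bij])
  qed
  thus "((\<lambda>l. prod_list (map f l) / fact (length l)) has_sum exp (\<Sum>\<^sub>\<infinity>i\<in>I. f i)) (lists I)"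
    unfolding has_sum_reindex_bij_betw[OF bij, of w] by (simp only: w_def S_def)
qed

text \<open>
  If the coefficients below \<open>n\<close> vanish, multiply the series by \<open>n ^ j\<close> and let \<open>j\<close> tend to infinity: all terms
  beyond the \<open>n\<close>-th die out, and only \<open>c n\<close> survives. Integer exponents suffice for this and spare
  complex powers.
\<close>
lemma dirichlet_coefficients_eq_0:
  fixes c :: "nat \<Rightarrow> complex"
  assumes sm: "(\<lambda>n. norm (c n / of_nat n ^ 2)) summable_on {1..}"
    and zero: "\<And>j. j \<ge> 2 \<Longrightarrow> (\<Sum>\<^sub>\<infinity>n\<in>{1..}. c n / of_nat n ^ j) = 0"
    and n: "n \<ge> 1"
  shows "c n = 0"
  using n
proof (induction n rule: less_induct)
  case (less n)
  \<comment> \<open>the \<open>m\<close>-th term of the series at \<open>j = k + 2\<close>, multiplied by \<open>n ^ j\<close>\<close>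
  define f where "f = (\<lambda>m k. c m / of_nat m ^ 2 * (of_nat n ^ 2 * of_real (real n / real m) ^ k))"
  define l where "l = (\<lambda>m. if m = n then c n else 0)"
  have "((\<lambda>k. \<Sum>\<^sub>\<infinity>m\<in>{1..}. f m k) \<longlongrightarrow> (\<Sum>\<^sub>\<infinity>m\<in>{1..}. l m)) sequentially"
  proof (rule tendsto_infsum_dominated)
    show "f m \<longlonglongrightarrow> l m" if "m \<in> {1..}" for m
    proof (cases m n rule: linorder_cases)
      case less
      thus ?thesis
        using less.IH[of m] that by (simp add: f_def l_def)
    next
      case equal
      thus ?thesis
        using less.prems by (simp add: f_def l_def)
    next
      case greater
      have "(\<lambda>k. complex_of_real (real n / real m) ^ k) \<longlonglongrightarrow> 0"
        using greater by (intro LIMSEQ_power_zero) (simp add: norm_divide)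
      hence "f m \<longlonglongrightarrow> c m / of_nat m ^ 2 * (of_nat n ^ 2 * 0)"
        unfolding f_def by (intro tendsto_mult tendsto_const)
      thus ?thesis
        using greater by (simp add: l_def)
    qed
    show "\<forall>\<^sub>F k in sequentially. \<forall>m\<in>{1..}. norm (f m k) \<le> norm (c m / of_nat m ^ 2) * real n ^ 2"
    proof (intro always_eventually allI ballI)
      fix k m :: nat assume m: "m \<in> {1..}"
      show "norm (f m k) \<le> norm (c m / of_nat m ^ 2) * real n ^ 2"
      proof (cases "m < n")
        case True
        thus ?thesis
          using less.IH[of m] m by (simp add: f_def)
      next
        case False
        hence "(real n / real m) ^ k \<le> 1"
          using m by (intro power_le_one) auto
        moreover have "norm (f m k) = norm (c m / of_nat m ^ 2) * (real n ^ 2 * (real n / real m) ^ k)"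
          unfolding f_def norm_mult[of "c m / of_nat m ^ 2"] by (simp add: norm_mult norm_power norm_divide)
        ultimately show ?thesis
          by (auto intro!: mult_left_mono mult_left_le)
      qed
    qed
    show "(\<lambda>m. norm (c m / of_nat m ^ 2) * real n ^ 2) summable_on {1..}"
      using sm by (rule summable_on_cmult_left)
  qed
  moreover have "(\<Sum>\<^sub>\<infinity>m\<in>{1..}. f m k) = 0" for k
  proof -
    have "(\<Sum>\<^sub>\<infinity>m\<in>{1..}. f m k) = (\<Sum>\<^sub>\<infinity>m\<in>{1..}. c m / of_nat m ^ (k + 2) * of_nat n ^ (k + 2))"
      by (intro infsum_cong) (simp add: f_def power_add power_divide power2_eq_square mult.assoc)
    also have "\<dots> = (\<Sum>\<^sub>\<infinity>m\<in>{1..}. c m / of_nat m ^ (k + 2)) * of_nat n ^ (k + 2)"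
      by (rule infsum_cmult_left')
    also have "\<dots> = 0"
      by (subst zero) auto
    finally show ?thesis .
  qed
  ultimately have "(\<Sum>\<^sub>\<infinity>m\<in>{1..}. l m) = 0"
    by (simp add: LIMSEQ_const_iff)
  also have "(\<Sum>\<^sub>\<infinity>m\<in>{1..}. l m) = (\<Sum>\<^sub>\<infinity>m\<in>{n}. l m)"
    by (rule infsum_cong_neutral) (use less.prems in \<open>auto simp: l_def\<close>)
  finally show ?case
    by (simp add: l_def)
qed

text \<open>
  In the expansion of the exponential over lists, a list contributes to the coefficient of the
  product of its integers. The product is 1 for the empty list alone, and since
  all factors are at least 2 it is a prime only for lists of length one. So the two sides
  agree in these coefficients by the uniqueness of Dirichlet coefficients.
\<close>
lemma exp_dirichlet_coefficients:
  fixes a :: "nat \<Rightarrow> complex" and \<beta> :: "'i \<Rightarrow> complex" and N :: "'i \<Rightarrow> nat"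
  assumes N: "\<And>i. i \<in> I \<Longrightarrow> N i \<ge> 2"
    and a: "\<And>j. j \<ge> 2 \<Longrightarrow> (\<lambda>n. norm (a n / of_nat n ^ j)) summable_on {1..}"
    and \<beta>: "\<And>j. j \<ge> 2 \<Longrightarrow> (\<lambda>i. norm (\<beta> i / of_nat (N i) ^ j)) summable_on I"
    and eq: "\<And>j. j \<ge> 2 \<Longrightarrow> (\<Sum>\<^sub>\<infinity>n\<in>{1..}. a n / of_nat n ^ j) = exp (\<Sum>\<^sub>\<infinity>i\<in>I. \<beta> i / of_nat (N i) ^ j)"
  shows "a 1 = 1"
    and "prime q \<Longrightarrow> {i \<in> I. N i = q} = {i0} \<Longrightarrow> a q = \<beta> i0"
proof -
  define M where "M l = prod_list (map N l)" for l
  define c where "c l = prod_list (map \<beta> l) / fact (length l)" for l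
  define fib where "fib n = {l \<in> lists I. M l = n}" for n
  define e where "e n = (\<Sum>\<^sub>\<infinity>l\<in>fib n. c l)" for n
  have N1: "N i > 0" "N i \<noteq> Suc 0" if "i \<in> I" for i
    using N[OF that] by linarith+
  have M_pos: "M l > 0" if "l \<in> lists I" for l
    using that by (induction l) (simp_all add: M_def N1)
  have M_1: "M l = 1 \<longleftrightarrow> l = []" if "l \<in> lists I" for l
    using that by (cases l) (simp_all add: M_def N1)
  have bij: "bij_betw snd (Sigma {1..} fib) (lists I)"
    by (rule bij_betwI[where g = "\<lambda>l. (M l, l)"]) (auto simp: fib_def Suc_le_eq M_pos)
  have term_eq: "prod_list (map (\<lambda>i. \<beta> i / of_nat (N i) ^ j) l) / fact (length l) = c l / of_nat (M l) ^ j" for j l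
  proof -
    have "prod_list (map (\<lambda>i. \<beta> i / of_nat (N i) ^ j) l) = prod_list (map \<beta> l) / of_nat (M l) ^ j"
      by (induction l) (auto simp: M_def power_mult_distrib)
    thus ?thesis
      by (simp add: c_def)
  qed
  have e: "((\<lambda>n. e n / of_nat n ^ j) has_sum exp (\<Sum>\<^sub>\<infinity>i\<in>I. \<beta> i / of_nat (N i) ^ j)) {1..}"
      "(\<lambda>n. norm (e n / of_nat n ^ j)) summable_on {1..}" if j: "j \<ge> 2" for j
  proof -
    note ex = has_sum_exp_lists[OF \<beta>[OF j], unfolded term_eq]
    have s1: "(\<lambda>x. c (snd x) / of_nat (M (snd x)) ^ j) summable_on (Sigma {1..} fib)"
      using has_sum_imp_summable[OF ex(1)]
      by (subst summable_on_reindex_bij_betw[OF bij, of "\<lambda>l. c l / of_nat (M l) ^ j"])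
    have s2: "(\<lambda>x. norm (c (snd x) / of_nat (M (snd x)) ^ j)) summable_on (Sigma {1..} fib)"
      using ex(2) by (subst summable_on_reindex_bij_betw[OF bij, of "\<lambda>l. norm (c l / of_nat (M l) ^ j)"])
    have h1: "((\<lambda>x. c (snd x) / of_nat (M (snd x)) ^ j) has_sum exp (\<Sum>\<^sub>\<infinity>i\<in>I. \<beta> i / of_nat (N i) ^ j)) (Sigma {1..} fib)"
      using ex(1) by (subst has_sum_reindex_bij_betw[OF bij, of "\<lambda>l. c l / of_nat (M l) ^ j"])
    have nfib: "(\<lambda>l. norm (c l / of_nat n ^ j)) summable_on fib n" if "n \<in> {1..}" for n
    proof -
      have "(\<lambda>l. norm (c l / of_nat (M l) ^ j)) summable_on fib n"
        using ex(2) by (rule summable_on_subset) (auto simp: fib_def)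
      thus ?thesis
        by (rule iffD1[OF summable_on_cong, rotated]) (auto simp: fib_def)
    qed
    have efib: "(\<Sum>\<^sub>\<infinity>l\<in>fib n. c l / of_nat n ^ j) = e n / of_nat n ^ j" for n
      unfolding e_def by (simp add: divide_inverse infsum_cmult_left')
    have inner: "((\<lambda>l. c (snd (n, l)) / of_nat (M (snd (n, l))) ^ j) has_sum e n / of_nat n ^ j) (fib n)"
      if n: "n \<in> {1..}" for n
    proof -
      have "((\<lambda>l. c l / of_nat n ^ j) has_sum e n / of_nat n ^ j) (fib n)"
        unfolding efib[symmetric] by (rule has_sum_infsum[OF abs_summable_summable[OF nfib[OF n]]])
      thus ?thesis
        by (rule iffD1[OF has_sum_cong, rotated]) (auto simp: fib_def)
    qed
    show "((\<lambda>n. e n / of_nat n ^ j) has_sum exp (\<Sum>\<^sub>\<infinity>i\<in>I. \<beta> i / of_nat (N i) ^ j)) {1..}"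
      by (rule has_sum_SigmaD[OF h1 inner])
    have "(\<lambda>n. \<Sum>\<^sub>\<infinity>l\<in>fib n. norm (c (snd (n, l)) / of_nat (M (snd (n, l))) ^ j)) summable_on {1..}"
    proof (rule summable_on_SigmaD[OF s2])
      show "(\<lambda>l. norm (c (snd (n, l)) / of_nat (M (snd (n, l))) ^ j)) summable_on fib n" if "n \<in> {1..}" for n
        using nfib[OF that] by (rule iffD1[OF summable_on_cong, rotated]) (auto simp: fib_def)
    qed
    also have "(\<lambda>n. \<Sum>\<^sub>\<infinity>l\<in>fib n. norm (c (snd (n, l)) / of_nat (M (snd (n, l))) ^ j)) =
        (\<lambda>n. \<Sum>\<^sub>\<infinity>l\<in>fib n. norm (c l / of_nat n ^ j))"
      by (intro ext infsum_cong) (auto simp: fib_def)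
    finally show "(\<lambda>n. norm (e n / of_nat n ^ j)) summable_on {1..}"
      by (rule summable_on_comparison_test)
         (use norm_infsum_bound[OF nfib] in \<open>auto simp: efib[symmetric]\<close>)
  qed
  have coeff: "a n = e n" if "n \<ge> 1" for n
  proof -
    have "a n - e n = 0"
    proof (rule dirichlet_coefficients_eq_0[OF _ _ that])
      have "(\<lambda>n. norm (a n / of_nat n ^ 2) + norm (e n / of_nat n ^ 2)) summable_on {1..}"
        by (intro summable_on_add a e) auto
      thus "(\<lambda>n. norm ((a n - e n) / of_nat n ^ 2)) summable_on {1..}"
        by (rule summable_on_comparison_test) (auto simp: diff_divide_distrib norm_triangle_ineq4)
      fix j :: nat assume j: "j \<ge> 2"
      have 1: "((\<lambda>n. a n / of_nat n ^ j) has_sum exp (\<Sum>\<^sub>\<infinity>i\<in>I. \<beta> i / of_nat (N i) ^ j)) {1..}"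
        unfolding eq[OF j, symmetric] by (rule has_sum_infsum[OF abs_summable_summable[OF a[OF j]]])
      show "(\<Sum>\<^sub>\<infinity>n\<in>{1..}. (a n - e n) / of_nat n ^ j) = 0"
        using infsumI[OF has_sum_add[OF 1 has_sum_uminusI[OF e(1)[OF j]]]]
        by (simp add: diff_divide_distrib)
    qed
    thus ?thesis
      by simp
  qed
  have "fib 1 = {[]}"
    using M_1 by (auto simp: fib_def)
  thus "a 1 = 1"
    using coeff[of 1] by (simp add: e_def c_def)
  show "a q = \<beta> i0" if q: "prime q" and i0: "{i \<in> I. N i = q} = {i0}"
  proof -
    have "fib q = {[i0]}"
    proof (intro equalityI subsetI)
      fix l assume "l \<in> fib q"
      hence l: "l \<in> lists I" "M l = q"
        by (auto simp: fib_def)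
      show "l \<in> {[i0]}"
      proof (cases l)
        case Nil
        thus ?thesis using l q by (auto simp: M_def)
      next
        case (Cons i l')
        hence il: "i \<in> I" "l' \<in> lists I" "N i * M l' = q"
          using l by (auto simp: M_def)
        hence "M l' = 1"
          using prime_product[of "N i" "M l'"] q N1[OF il(1)] by simp
        hence "l' = []" "N i = q"
          using il M_1 by auto
        thus ?thesis
          using Cons il i0 by auto
      qed
    next
      fix l assume "l \<in> {[i0]}"
      thus "l \<in> fib q"
        using i0 by (auto simp: fib_def M_def)
    qed
    thus ?thesis
      using coeff[of q] prime_ge_1_nat[OF q] by (simp add: e_def c_def)
  qed
qed

section \<open>The bound by zeta(7/4)\<close>

text \<open>
  By the mean value theorem; summed over \<open>x\<close>, the right-hand side telescopes.
\<close>
lemma powr_neg_7_4_le_diff: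
  assumes x: "x > (1::real)"
  shows "x powr (-7/4) \<le> 4/3 * ((x - 1) powr (-3/4) - x powr (-3/4))"
proof -
  have "\<exists>\<xi>. x - 1 < \<xi> \<and> \<xi> < x \<and>
      x powr (-3/4) - (x - 1) powr (-3/4) = (x - (x - 1)) * (-3/4 * \<xi> powr (-3/4 - 1))"
    using x by (intro MVT2) (auto intro!: derivative_eq_intros)
  then obtain \<xi> where \<xi>: "x - 1 < \<xi>" "\<xi> < x" "x powr (-3/4) - (x - 1) powr (-3/4) = -3/4 * \<xi> powr (-7/4)"
    by auto
  have "x powr (-7/4) \<le> \<xi> powr (-7/4)"
    using \<xi> x by (intro powr_mono2') auto
  thus ?thesis
    using \<xi>(3) by simp
qed

text \<open>It reduces the numerical bounds below to comparisons of rational numbers.\<close>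
lemma powr_neg_quarters_le:
  assumes "0 < x" "0 < u" "1 \<le> u ^ 4 * x ^ k"
  shows "x powr (- (real k / 4)) \<le> u"
proof -
  have "(x powr (- (real k / 4))) ^ 4 = x powr (- real k)"
    using assms by (simp add: powr_power)
  also have "\<dots> = 1 / x ^ k"
    using assms by (simp add: powr_minus_divide powr_realpow)
  also have "\<dots> \<le> u ^ 4"
    using assms by (simp add: divide_le_eq)
  finally show ?thesis
    using assms by (subst (asm) power_mono_iff) auto
qed

text \<open>
  The value of \<open>\<zeta>(7/4) - 1\<close> is about \<open>0.963\<close>, so there is little room below 1: applied
  from \<open>n = 5\<close> on, the telescoping estimate would give a bound above 1. Hence four terms are
  evaluated separately.
\<close>
lemma zeta_7_4_minus_1_partial:
  assumes "M \<ge> 5"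
  shows "(\<Sum>n=2..M. real n powr (-7/4)) \<le> 991/1000 - 4/3 * real M powr (-3/4)"
  using assms
proof (induction M rule: dec_induct)
  case base
  have "2 powr (-7/4) \<le> (2974/10000 :: real)" "3 powr (-7/4) \<le> (1463/10000 :: real)"
       "4 powr (-7/4) \<le> (884/10000 :: real)" "5 powr (-7/4) \<le> (599/10000 :: real)"
       "5 powr (-3/4) \<le> (2991/10000 :: real)"
    using powr_neg_quarters_le[of 2 "2974/10000" 7] powr_neg_quarters_le[of 3 "1463/10000" 7]
      powr_neg_quarters_le[of 4 "884/10000" 7] powr_neg_quarters_le[of 5 "599/10000" 7]
      powr_neg_quarters_le[of 5 "2991/10000" 3]
    by (simp_all add: power_divide)
  moreover have "{2..5::nat} = {2, 3, 4, 5}"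
    by auto
  ultimately show ?case
    by simp
next
  case (step n)
  have "(\<Sum>m=2..Suc n. real m powr (-7/4)) = (\<Sum>m=2..n. real m powr (-7/4)) + real (Suc n) powr (-7/4)"
    using step.hyps by simp
  thus ?case
    using powr_neg_7_4_le_diff[of "real (Suc n)"] step by simp
qed

lemma zeta_7_4_minus_1:
  shows "(\<lambda>n. real n powr (-7/4)) summable_on {2..}"
    and "(\<Sum>\<^sub>\<infinity>n\<in>{2..}. real n powr (-7/4)) \<le> 991/1000"
proof -
  have "(\<lambda>n. real n powr (-7/4)) summable_on UNIV"
    using summable_real_powr_iff[of "-7/4"] by (intro summable_nonneg_imp_summable_on) auto
  thus sm: "(\<lambda>n. real n powr (-7/4)) summable_on {2..}"
    by (rule summable_on_subset_banach) auto
  show "(\<Sum>\<^sub>\<infinity>n\<in>{2..}. real n powr (-7/4)) \<le> 991/1000"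
  proof (rule infsum_le_finite_sums[OF sm])
    fix F :: "nat set" assume F: "finite F" "F \<subseteq> {2..}"
    define M where "M = Max (insert 5 F)"
    have M: "M \<ge> 5" "\<And>n. n \<in> F \<Longrightarrow> n \<le> M"
      using F by (auto simp: M_def)
    have "(\<Sum>n\<in>F. real n powr (-7/4)) \<le> (\<Sum>n=2..M. real n powr (-7/4))"
      using F M by (intro sum_mono2) auto
    also have "\<dots> \<le> 991/1000 - 4/3 * real M powr (-3/4)"
      by (rule zeta_7_4_minus_1_partial[OF M(1)])
    finally show "(\<Sum>n\<in>F. real n powr (-7/4)) \<le> 991/1000"
      using powr_ge_zero[of "real M" "-3/4"] by linarith
  qed
qed

lemma norm_dirichlet_series_minus_1_le:
  assumes sm: "(\<lambda>n. norm (a n / of_nat n powr s)) summable_on {1..}"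
    and a1: "a 1 = 1" and a: "\<And>n. n \<ge> 2 \<Longrightarrow> norm (a n) \<le> real n powr (1 / 4)" and s: "Re s \<ge> 2"
  shows "norm (dirichlet_series a s - 1) \<le> 991/1000"
proof -
  have "((\<lambda>n. a n / of_nat n powr s) has_sum dirichlet_series a s) {1..}"
    unfolding dirichlet_series_def by (rule has_sum_infsum[OF abs_summable_summable[OF sm]])
  moreover have "((\<lambda>n. a n / of_nat n powr s) has_sum 1) {1}"
    by (rule has_sum_finiteI) (use a1 in auto)
  ultimately have "((\<lambda>n. a n / of_nat n powr s) has_sum (dirichlet_series a s - 1)) ({1..} - {1})"
    by (rule has_sum_Diff) auto
  also have "{1..} - {1} = {2::nat..}"
    by auto
  finally have "norm (dirichlet_series a s - 1) \<le> (\<Sum>\<^sub>\<infinity>n\<in>{2..}. real n powr (-7/4))"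
  proof (rule norm_infsum_le[OF _ has_sum_infsum[OF zeta_7_4_minus_1(1)]])
    fix n :: nat assume n: "n \<in> {2..}"
    have "norm (a n / of_nat n powr s) = norm (a n) / real n powr Re s"
      by (subst norm_divide, subst norm_powr_real_powr) auto
    also have "\<dots> \<le> real n powr (1 / 4) / real n powr Re s"
      using n by (intro divide_right_mono a) auto
    also have "\<dots> = real n powr (1 / 4 - Re s)"
      by (simp add: powr_diff)
    also have "\<dots> \<le> real n powr (-7/4)"
      using n s by (intro powr_mono) auto
    finally show "norm (a n / of_nat n powr s) \<le> real n powr (-7/4)" .
  qed
  thus ?thesis
    using zeta_7_4_minus_1(2) by linarith
qed

section \<open>The twisted logarithm\<close>

text \<open>The pair \<open>(p, k)\<close> stands for the prime power \<open>p ^ k\<close>.\<close>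
abbreviation (input) prime_exponents :: "(nat \<times> nat) set" where
  "prime_exponents \<equiv> {p. prime p} \<times> {1..}"

abbreviation (input) unimodular :: "(nat \<Rightarrow> complex) \<Rightarrow> bool" where
  "unimodular z \<equiv> \<forall>p. norm (z p) = 1"

locale prime_power_exponent =
  fixes b :: "nat \<Rightarrow> complex" and K \<theta> :: real
  assumes abs_conv: "\<And>s. Re s > 1 \<Longrightarrow>
      (\<lambda>(p, k). norm (b (p ^ k) / of_nat p powr (of_nat k * s))) summable_on prime_exponents"
    and K_pos: "K > 0" and \<theta>_less: "\<theta> < 1 / 2"
    and b_bound: "\<And>p k. prime p \<Longrightarrow> k \<ge> 1 \<Longrightarrow> norm (b (p ^ k)) \<le> K * real p powr (real k * \<theta>)"
begin

definition weight :: "real \<Rightarrow> nat \<times> nat \<Rightarrow> real" where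
  "weight \<sigma> i = norm (b (fst i ^ snd i)) / real (fst i) powr (real (snd i) * \<sigma>)"

text \<open>
  The twist multiplies \<open>p powr (-s)\<close> by \<open>z p\<close>, and hence the term of \<open>p ^ k\<close> by \<open>z p ^ k\<close>. For
  \<open>z p = p powr (-i\<tau>)\<close> this is a vertical shift by \<open>\<tau>\<close>.
\<close>
definition twisted_term :: "(nat \<Rightarrow> complex) \<Rightarrow> complex \<Rightarrow> nat \<times> nat \<Rightarrow> complex" where
  "twisted_term z s i = b (fst i ^ snd i) * z (fst i) ^ snd i / of_nat (fst i) powr (of_nat (snd i) * s)"

definition twisted_log :: "(nat \<Rightarrow> complex) \<Rightarrow> complex \<Rightarrow> complex" where
  "twisted_log z s = (\<Sum>\<^sub>\<infinity>i\<in>prime_exponents. twisted_term z s i)"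

definition total_weight :: "real \<Rightarrow> real" where
  "total_weight \<sigma> = (\<Sum>\<^sub>\<infinity>i\<in>prime_exponents. weight \<sigma> i)"

lemma prime_exponents_pos: "i \<in> prime_exponents \<Longrightarrow> fst i \<ge> 2" "i \<in> prime_exponents \<Longrightarrow> snd i \<ge> 1"
  by (auto dest: prime_ge_2_nat)

lemma weight_nonneg: "weight \<sigma> i \<ge> 0"
  by (simp add: weight_def)

lemma norm_of_nat_powr: "norm (of_nat n powr s :: complex) = real n powr Re s"
  by (subst norm_powr_real_powr) auto

lemma norm_twisted_term:
  assumes "norm (z (fst i)) = 1"
  shows "norm (twisted_term z s i) = weight (Re s) i"
  using assms by (simp add: twisted_term_def weight_def norm_mult norm_divide norm_power norm_of_nat_powr)

lemma weight_summable:
  assumes "\<sigma> > 1"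
  shows "weight \<sigma> summable_on prime_exponents"
proof -
  have "(\<lambda>(p, k). norm (b (p ^ k) / of_nat p powr (of_nat k * of_real \<sigma>))) summable_on prime_exponents"
    using assms by (intro abs_conv) simp
  also have "(\<lambda>(p, k). norm (b (p ^ k) / of_nat p powr (of_nat k * of_real \<sigma>))) = weight \<sigma>"
    by (auto simp: fun_eq_iff weight_def norm_divide norm_of_nat_powr)
  finally show ?thesis .
qed

text \<open>
  Every prime power is at least 2. This gives a rate at which the series tends to 0 to the right, uniform in the
  twist.
\<close>
lemma weight_decay:
  assumes "\<sigma> \<le> \<sigma>'" and i: "i \<in> prime_exponents"
  shows "weight \<sigma>' i \<le> weight \<sigma> i * 2 powr (\<sigma> - \<sigma>')"
proof -
  define p k where "p = fst i" and "k = snd i"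
  have pk: "p \<ge> 2" "k \<ge> 1"
    using prime_exponents_pos[OF i] by (auto simp: p_def k_def)
  have "2 powr (\<sigma>' - \<sigma>) \<le> real p powr (\<sigma>' - \<sigma>)"
    using pk assms by (intro powr_mono2) auto
  also have "\<dots> \<le> real p powr (real k * (\<sigma>' - \<sigma>))"
    using pk assms mult_right_mono[of 1 "real k" "\<sigma>' - \<sigma>"] by (intro powr_mono) auto
  finally have "1 / real p powr (real k * (\<sigma>' - \<sigma>)) \<le> 1 / 2 powr (\<sigma>' - \<sigma>)"
    using pk by (intro divide_left_mono mult_pos_pos) auto
  hence "norm (b (p ^ k)) / real p powr (real k * \<sigma>) * (1 / real p powr (real k * (\<sigma>' - \<sigma>)))
      \<le> norm (b (p ^ k)) / real p powr (real k * \<sigma>) * (1 / 2 powr (\<sigma>' - \<sigma>))"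
    by (intro mult_left_mono) auto
  moreover have "real p powr (real k * \<sigma>') = real p powr (real k * \<sigma>) * real p powr (real k * (\<sigma>' - \<sigma>))"
    by (simp add: powr_add[symmetric] algebra_simps)
  moreover have "2 powr (\<sigma> - \<sigma>') = 1 / 2 powr (\<sigma>' - \<sigma>)"
    by (simp add: powr_minus_divide[symmetric])
  ultimately show ?thesis
    by (simp add: weight_def p_def k_def)
qed

lemma weight_antimono:
  assumes "\<sigma> \<le> \<sigma>'" and i: "i \<in> prime_exponents"
  shows "weight \<sigma>' i \<le> weight \<sigma> i"
proof -
  have "2 powr (\<sigma> - \<sigma>') \<le> 2 powr (0::real)"
    using assms by (intro powr_mono) auto
  hence "weight \<sigma> i * 2 powr (\<sigma> - \<sigma>') \<le> weight \<sigma> i * 1"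
    using weight_nonneg by (intro mult_left_mono) auto
  thus ?thesis
    using weight_decay[OF assms] by simp
qed

lemma total_weight_nonneg: "total_weight \<sigma> \<ge> 0"
  unfolding total_weight_def by (intro infsum_nonneg weight_nonneg)

lemma total_weight_decay:
  assumes "1 < \<sigma>" "\<sigma> \<le> \<sigma>'"
  shows "total_weight \<sigma>' \<le> total_weight \<sigma> * 2 powr (\<sigma> - \<sigma>')"
proof -
  have "total_weight \<sigma>' \<le> (\<Sum>\<^sub>\<infinity>i\<in>prime_exponents. weight \<sigma> i * 2 powr (\<sigma> - \<sigma>'))"
    unfolding total_weight_def using assms
    by (intro infsum_mono weight_summable summable_on_cmult_left weight_decay) auto
  also have "\<dots> = total_weight \<sigma> * 2 powr (\<sigma> - \<sigma>')"
    unfolding total_weight_def by (rule infsum_cmult_left')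
  finally show ?thesis .
qed

lemma twisted_term_summable:
  assumes "unimodular z" "Re s > 1"
  shows "(\<lambda>i. norm (twisted_term z s i)) summable_on prime_exponents"
  using weight_summable[OF assms(2)] by (simp add: norm_twisted_term assms(1))

lemma twisted_log_has_sum:
  assumes "unimodular z" "Re s > 1"
  shows "(twisted_term z s has_sum twisted_log z s) prime_exponents"
  unfolding twisted_log_def by (rule has_sum_infsum[OF abs_summable_summable[OF twisted_term_summable[OF assms]]])

lemma norm_twisted_log_le:
  assumes "unimodular z" "Re s > 1"
  shows "norm (twisted_log z s) \<le> total_weight (Re s)"
  using norm_infsum_bound[OF twisted_term_summable[OF assms]]
  by (simp add: twisted_log_def total_weight_def norm_twisted_term assms(1))

lemma norm_twisted_log_decay:
  assumes "unimodular z" "1 < \<sigma>" "\<sigma> \<le> Re s"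
  shows "norm (twisted_log z s) \<le> total_weight \<sigma> * 2 powr (\<sigma> - Re s)"
  by (rule order_trans[OF norm_twisted_log_le total_weight_decay]) (use assms in auto)

lemma twisted_log_tendsto:
  assumes lim: "\<And>p. prime p \<Longrightarrow> ((\<lambda>x. Z x p) \<longlongrightarrow> z p) F"
    and Z: "\<forall>\<^sub>F x in F. unimodular (Z x)" and s: "Re s > 1"
  shows "((\<lambda>x. twisted_log (Z x) s) \<longlongrightarrow> twisted_log z s) F"
  unfolding twisted_log_def
proof (rule tendsto_infsum_dominated[OF _ _ weight_summable[OF s]])
  show "((\<lambda>x. twisted_term (Z x) s i) \<longlongrightarrow> twisted_term z s i) F" if "i \<in> prime_exponents" for i
    unfolding twisted_term_def divide_inverse using that by (intro tendsto_intros lim) auto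
  show "\<forall>\<^sub>F x in F. \<forall>i\<in>prime_exponents. norm (twisted_term (Z x) s i) \<le> weight (Re s) i"
    using Z by eventually_elim (simp add: norm_twisted_term)
qed

text \<open>
  The map \<open>g\<close> will be multiplication by \<open>j\<close>. The difference of the two series is dominated by a sum
  \<open>D x\<close> which does not depend on \<open>s\<close> and tends to 0 by dominated convergence.
\<close>
lemma twisted_log_uniform_limit:
  assumes lim: "\<And>p. prime p \<Longrightarrow> ((\<lambda>x. Z x p) \<longlongrightarrow> z p) F"
    and Z: "\<And>x. unimodular (Z x)" and z: "unimodular z"
    and \<sigma>: "\<sigma> > 1" and g: "\<And>s. s \<in> X \<Longrightarrow> Re (g s) \<ge> \<sigma>"
  shows "uniform_limit X (\<lambda>x s. twisted_log (Z x) (g s)) (\<lambda>s. twisted_log z (g s)) F"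
proof -
  define D where "D x = (\<Sum>\<^sub>\<infinity>i\<in>prime_exponents. weight \<sigma> i * norm (Z x (fst i) ^ snd i - z (fst i) ^ snd i))" for x
  have le2: "norm (Z x p ^ k - z p ^ k) \<le> 2" for x p k
    using norm_triangle_ineq4[of "Z x p ^ k" "z p ^ k"] Z z by (simp add: norm_power)
  have dom: "weight \<sigma> i * norm (Z x (fst i) ^ snd i - z (fst i) ^ snd i) \<le> weight \<sigma> i * 2" for x i
    by (intro mult_left_mono le2 weight_nonneg)
  have sm2: "(\<lambda>i. weight \<sigma> i * 2) summable_on prime_exponents"
    by (intro summable_on_cmult_left weight_summable \<sigma>)
  have smD: "(\<lambda>i. weight \<sigma> i * norm (Z x (fst i) ^ snd i - z (fst i) ^ snd i)) summable_on prime_exponents" for x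
    by (rule summable_on_comparison_test[OF sm2 dom]) (simp add: weight_nonneg)
  have "(D \<longlongrightarrow> (\<Sum>\<^sub>\<infinity>i\<in>prime_exponents. 0)) F"
    unfolding D_def
  proof (rule tendsto_infsum_dominated[OF _ _ sm2])
    show "((\<lambda>x. weight \<sigma> i * norm (Z x (fst i) ^ snd i - z (fst i) ^ snd i)) \<longlongrightarrow> 0) F"
      if i: "i \<in> prime_exponents" for i
    proof -
      have "((\<lambda>x. weight \<sigma> i * norm (Z x (fst i) ^ snd i - z (fst i) ^ snd i)) \<longlongrightarrow>
          weight \<sigma> i * norm (z (fst i) ^ snd i - z (fst i) ^ snd i)) F"
        using i by (intro tendsto_intros lim) auto
      thus ?thesis by simp
    qed
    show "\<forall>\<^sub>F x in F. \<forall>i\<in>prime_exponents.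
        norm (weight \<sigma> i * norm (Z x (fst i) ^ snd i - z (fst i) ^ snd i)) \<le> weight \<sigma> i * 2"
      using dom by (simp add: abs_mult weight_nonneg)
  qed
  hence D: "(D \<longlongrightarrow> 0) F"
    by simp
  have diff: "norm (twisted_log (Z x) (g s) - twisted_log z (g s)) \<le> D x" if s: "s \<in> X" for x s
  proof -
    have s1: "Re (g s) > 1"
      using g[OF s] \<sigma> by linarith
    have "((\<lambda>i. twisted_term (Z x) (g s) i + - twisted_term z (g s) i) has_sum
        (twisted_log (Z x) (g s) + - twisted_log z (g s))) prime_exponents"
      by (rule has_sum_add[OF twisted_log_has_sum[OF Z s1] has_sum_uminusI[OF twisted_log_has_sum[OF z s1]]])
    moreover have "((\<lambda>i. weight \<sigma> i * norm (Z x (fst i) ^ snd i - z (fst i) ^ snd i)) has_sum D x) prime_exponents"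
      unfolding D_def by (rule has_sum_infsum[OF smD])
    moreover have "norm (twisted_term (Z x) (g s) i + - twisted_term z (g s) i)
        \<le> weight \<sigma> i * norm (Z x (fst i) ^ snd i - z (fst i) ^ snd i)" if i: "i \<in> prime_exponents" for i
    proof -
      have "twisted_term (Z x) (g s) i + - twisted_term z (g s) i =
          b (fst i ^ snd i) / of_nat (fst i) powr (of_nat (snd i) * g s) * (Z x (fst i) ^ snd i - z (fst i) ^ snd i)"
        by (simp add: twisted_term_def algebra_simps diff_divide_distrib)
      also have "norm \<dots> = weight (Re (g s)) i * norm (Z x (fst i) ^ snd i - z (fst i) ^ snd i)"
        by (simp add: norm_mult norm_divide weight_def norm_of_nat_powr)
      also have "\<dots> \<le> weight \<sigma> i * norm (Z x (fst i) ^ snd i - z (fst i) ^ snd i)"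
        by (intro mult_right_mono weight_antimono g s i) auto
      finally show ?thesis .
    qed
    ultimately have "norm (twisted_log (Z x) (g s) + - twisted_log z (g s)) \<le> D x"
      by (rule norm_infsum_le)
    thus ?thesis by simp
  qed
  show ?thesis
  proof (rule uniform_limitI)
    fix e :: real assume "e > 0"
    hence "\<forall>\<^sub>F x in F. D x < e"
      using D by (simp add: order_tendsto_iff)
    thus "\<forall>\<^sub>F x in F. \<forall>s\<in>X. dist (twisted_log (Z x) (g s)) (twisted_log z (g s)) < e"
      by eventually_elim (auto simp: dist_norm intro: le_less_trans[OF diff])
  qed
qed

lemma twisted_log_holomorphic:
  assumes z: "unimodular z"
  shows "twisted_log z holomorphic_on {s. Re s > 1}"
proof -
  have "\<exists>r>0. twisted_log z holomorphic_on ball s r" if s: "Re s > 1" for s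
  proof -
    define r where "r = (Re s - 1) / 2"
    have r: "r > 0"
      using s by (simp add: r_def)
    have Re_ge: "Re w \<ge> 1 + r" if "w \<in> cball s r" for w
      using that abs_Re_le_cmod[of "s - w"] by (auto simp: dist_norm r_def field_simps)
    have "uniform_limit (cball s r) (\<lambda>X w. \<Sum>i\<in>X. twisted_term z w i) (\<lambda>w. twisted_log z w)
        (finite_subsets_at_top prime_exponents)"
      unfolding twisted_log_def
    proof (rule Weierstrass_m_test_general)
      show "weight (1 + r) summable_on prime_exponents"
        using r by (intro weight_summable) auto
      show "norm (twisted_term z w i) \<le> weight (1 + r) i" if "i \<in> prime_exponents" "w \<in> cball s r" for i w
        using weight_antimono[OF Re_ge[OF that(2)] that(1)] z by (simp add: norm_twisted_term)
    qed
    moreover have "(\<lambda>w. \<Sum>i\<in>X. twisted_term z w i) holomorphic_on A"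
      if X: "X \<subseteq> prime_exponents" for X A
      unfolding twisted_term_def
      by (intro holomorphic_intros) (use X prime_gt_0_nat in \<open>fastforce+\<close>)
    hence "\<forall>\<^sub>F X in finite_subsets_at_top prime_exponents.
        continuous_on (cball s r) (\<lambda>w. \<Sum>i\<in>X. twisted_term z w i) \<and>
        (\<lambda>w. \<Sum>i\<in>X. twisted_term z w i) holomorphic_on ball s r"
      by (intro eventually_finite_subsets_at_top_weakI conjI holomorphic_on_imp_continuous_on) auto
    ultimately have "twisted_log z holomorphic_on ball s r"
      using holomorphic_uniform_limit[of s r "\<lambda>X w. \<Sum>i\<in>X. twisted_term z w i"
          "finite_subsets_at_top prime_exponents" "twisted_log z"] by auto
    thus ?thesis
      using r by blast
  qed
  hence "\<forall>s\<in>{s. Re s > 1}. twisted_log z field_differentiable at s"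
    by (metis centre_in_ball holomorphic_on_imp_differentiable_at mem_Collect_eq open_ball)
  thus ?thesis
    by (auto simp: holomorphic_on_def intro: field_differentiable_at_within)
qed

lemma twisted_log_vertical_shift:
  "twisted_log z (s + \<i> * of_real \<tau>) = twisted_log (\<lambda>p. z p * of_nat p powr (- (\<i> * of_real \<tau>))) s"
  unfolding twisted_log_def
proof (rule infsum_cong)
  fix i assume i: "i \<in> prime_exponents"
  define p k where "p = fst i" and "k = snd i"
  have p: "of_nat p \<noteq> (0 :: complex)"
    using prime_exponents_pos(1)[OF i] by (simp add: p_def)
  have "of_nat p powr (of_nat k * (s + \<i> * of_real \<tau>)) =
      of_nat p powr (of_nat k * s) * (of_nat p powr (\<i> * of_real \<tau>)) ^ k"
    using p by (simp add: powr_power powr_add[symmetric] algebra_simps)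
  hence "twisted_term z (s + \<i> * of_real \<tau>) i =
      b (p ^ k) * (z p ^ k * inverse (of_nat p powr (\<i> * of_real \<tau>)) ^ k) / of_nat p powr (of_nat k * s)"
    by (simp add: twisted_term_def p_def k_def field_simps)
  thus "twisted_term z (s + \<i> * of_real \<tau>) i = twisted_term (\<lambda>p. z p * of_nat p powr (- (\<i> * of_real \<tau>))) s i"
    by (simp add: twisted_term_def p_def k_def power_mult_distrib powr_minus)
qed

section \<open>From one twisted zero to infinitely many zeros\<close>

text \<open>
  A vertical shift of \<open>s\<close> by \<open>\<tau>\<close> shifts \<open>js\<close> by \<open>j\<tau>\<close>, so the twist of \<open>L(js)\<close> is by \<open>z p ^ j\<close>: one point \<open>z\<close>
  governs all the summands.
\<close>
definition twisted_sum :: "nat \<Rightarrow> (nat \<Rightarrow> complex) \<Rightarrow> complex \<Rightarrow> complex" where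
  "twisted_sum N z s = (\<Sum>j=1..N. exp (twisted_log (\<lambda>p. z p ^ j) (of_nat j * s)))"

lemma Re_mult_nat_ge: "j \<ge> 1 \<Longrightarrow> 0 \<le> c \<Longrightarrow> c \<le> Re s \<Longrightarrow> c \<le> Re (of_nat j * s)"
  using mult_mono[of 1 "real j" c "Re s"] by simp

lemma unimodular_power: "unimodular z \<Longrightarrow> unimodular (\<lambda>p. z p ^ j)"
  by (simp add: norm_power)

lemma twisted_sum_vertical_shift:
  "twisted_sum N z (s + \<i> * of_real \<tau>) = twisted_sum N (\<lambda>p. z p * of_nat p powr (- (\<i> * of_real \<tau>))) s"
  unfolding twisted_sum_def
proof (intro sum.cong refl arg_cong[where f = exp])
  fix j
  have "of_nat j * (s + \<i> * of_real \<tau>) = of_nat j * s + \<i> * of_real (real j * \<tau>)"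
    by (simp add: algebra_simps)
  hence "twisted_log (\<lambda>p. z p ^ j) (of_nat j * (s + \<i> * of_real \<tau>)) =
      twisted_log (\<lambda>p. z p ^ j * of_nat p powr (- (\<i> * of_real (real j * \<tau>)))) (of_nat j * s)"
    by (simp only: twisted_log_vertical_shift)
  also have "\<dots> = twisted_log (\<lambda>p. (z p * of_nat p powr (- (\<i> * of_real \<tau>))) ^ j) (of_nat j * s)"
    unfolding twisted_log_def
  proof (rule infsum_cong)
    fix i assume i: "i \<in> prime_exponents"
    have "(of_nat (fst i) powr (- (\<i> * of_real \<tau>))) ^ j = (of_nat (fst i) :: complex) powr (- (\<i> * of_real (real j * \<tau>)))"
      using prime_exponents_pos(1)[OF i] by (subst powr_power) (auto simp: algebra_simps)
    thus "twisted_term (\<lambda>p. z p ^ j * of_nat p powr (- (\<i> * of_real (real j * \<tau>)))) (of_nat j * s) i =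
        twisted_term (\<lambda>p. (z p * of_nat p powr (- (\<i> * of_real \<tau>))) ^ j) (of_nat j * s) i"
      by (simp only: twisted_term_def power_mult_distrib)
  qed
  finally show "twisted_log (\<lambda>p. z p ^ j) (of_nat j * (s + \<i> * of_real \<tau>)) =
      twisted_log (\<lambda>p. (z p * of_nat p powr (- (\<i> * of_real \<tau>))) ^ j) (of_nat j * s)" .
qed

lemma twisted_sum_holomorphic:
  assumes "unimodular z"
  shows "twisted_sum N z holomorphic_on {s. Re s > 1}"
proof -
  have "(\<lambda>s. twisted_log (\<lambda>p. z p ^ j) (of_nat j * s)) holomorphic_on {s. Re s > 1}" if "j \<in> {1..N}" for j
  proof -
    have "(twisted_log (\<lambda>p. z p ^ j) \<circ> (\<lambda>s. of_nat j * s)) holomorphic_on {s. Re s > 1}"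
    proof (rule holomorphic_on_compose_gen[OF _ twisted_log_holomorphic])
      show "unimodular (\<lambda>p. z p ^ j)"
        using assms by (simp add: norm_power)
      show "(\<lambda>s. of_nat j * s) ` {s. Re s > 1} \<subseteq> {s. Re s > 1}"
      proof safe
        fix s assume "Re s > 1"
        moreover from this have "Re s \<le> Re (of_nat j * s)"
          using that by (intro Re_mult_nat_ge) auto
        ultimately show "Re (of_nat j * s) > 1"
          by linarith
      qed
    qed (intro holomorphic_intros)
    thus ?thesis
      by (simp add: o_def)
  qed
  thus ?thesis
    unfolding twisted_sum_def[abs_def] by (intro holomorphic_intros)
qed

text \<open>This limit shows that a twisted sum with a zero is not constant.\<close>
lemma twisted_sum_at_infinity:
  assumes z: "unimodular z" and s: "Re s > 1"
  shows "(\<lambda>n. twisted_sum N z (s + of_nat n)) \<longlonglongrightarrow> of_nat N"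
proof -
  have "(\<lambda>n. twisted_log (\<lambda>p. z p ^ j) (of_nat j * (s + of_nat n))) \<longlonglongrightarrow> 0" if j: "j \<in> {1..N}" for j
  proof (rule Lim_null_comparison)
    have "norm (twisted_log (\<lambda>p. z p ^ j) (of_nat j * (s + of_nat n))) \<le> total_weight (Re s) * (1 / 2) ^ n" for n
    proof -
      have ge: "Re (of_nat j * (s + of_nat n)) \<ge> Re s + real n"
        using j s by (intro Re_mult_nat_ge) auto
      have "norm (twisted_log (\<lambda>p. z p ^ j) (of_nat j * (s + of_nat n)))
          \<le> total_weight (Re s) * 2 powr (Re s - Re (of_nat j * (s + of_nat n)))"
        by (rule norm_twisted_log_decay[OF unimodular_power[OF z] s]) (use ge in linarith)
      also have "\<dots> \<le> total_weight (Re s) * 2 powr (- real n)"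
        using ge by (intro mult_left_mono powr_mono total_weight_nonneg) auto
      also have "2 powr (- real n) = (1 / 2) ^ n"
        by (simp add: powr_minus powr_realpow power_one_over inverse_eq_divide)
      finally show ?thesis .
    qed
    thus "\<forall>\<^sub>F n in sequentially. norm (twisted_log (\<lambda>p. z p ^ j) (of_nat j * (s + of_nat n)))
        \<le> total_weight (Re s) * (1 / 2) ^ n"
      by simp
    show "(\<lambda>n. total_weight (Re s) * (1 / 2) ^ n) \<longlonglongrightarrow> 0"
      by (intro tendsto_mult_right_zero LIMSEQ_power_zero) auto
  qed
  hence "(\<lambda>n. twisted_sum N z (s + of_nat n)) \<longlonglongrightarrow> (\<Sum>j=1..N. exp 0)"
    unfolding twisted_sum_def by (intro tendsto_sum tendsto_exp)
  thus ?thesis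
    by simp
qed

lemma twisted_sum_uniform_limit:
  assumes lim: "\<And>p. prime p \<Longrightarrow> ((\<lambda>x. Z x p) \<longlongrightarrow> z p) F"
    and Z: "\<And>x. unimodular (Z x)" and z: "unimodular z"
    and C: "compact C" "C \<subseteq> {s. Re s > 1}"
  shows "uniform_limit C (\<lambda>x. twisted_sum N (Z x)) (twisted_sum N z) F"
proof (cases "C = {}")
  case False
  have "continuous_on C Re"
    by (intro continuous_intros)
  then obtain s0 where s0: "s0 \<in> C" "\<And>s. s \<in> C \<Longrightarrow> Re s0 \<le> Re s"
    using continuous_attains_inf[OF C(1) False] by blast
  define \<sigma> where "\<sigma> = Re s0"
  have \<sigma>: "\<sigma> > 1"
    using s0(1) C(2) by (auto simp: \<sigma>_def)
  have ul: "uniform_limit C (\<lambda>x s. exp (twisted_log (\<lambda>p. Z x p ^ j) (of_nat j * s)))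
      (\<lambda>s. exp (twisted_log (\<lambda>p. z p ^ j) (of_nat j * s))) F" if j: "j \<in> {1..N}" for j
  proof (rule uniform_limit_compose_uniformly_continuous_on[where f = exp
        and g = "\<lambda>x s. twisted_log (\<lambda>p. Z x p ^ j) (of_nat j * s)"
        and g' = "\<lambda>s. twisted_log (\<lambda>p. z p ^ j) (of_nat j * s)"
        and B = "cball 0 (total_weight \<sigma>)"])
    have ge: "Re (of_nat j * s) \<ge> \<sigma>" if "s \<in> C" for s
      using s0(2)[OF that] j \<sigma> by (intro Re_mult_nat_ge) (auto simp: \<sigma>_def)
    show "uniform_limit C (\<lambda>x s. twisted_log (\<lambda>p. Z x p ^ j) (of_nat j * s))
        (\<lambda>s. twisted_log (\<lambda>p. z p ^ j) (of_nat j * s)) F"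
      using Z z by (intro twisted_log_uniform_limit[OF _ _ _ \<sigma> ge] tendsto_power lim) (auto simp: norm_power)
    show "uniformly_continuous_on (cball 0 (total_weight \<sigma>)) (exp :: complex \<Rightarrow> complex)"
      by (intro compact_uniformly_continuous continuous_intros) auto
    show "\<forall>\<^sub>F x in F. \<forall>s\<in>C. twisted_log (\<lambda>p. Z x p ^ j) (of_nat j * s) \<in> cball 0 (total_weight \<sigma>)"
    proof (intro always_eventually allI ballI)
      fix x s assume s: "s \<in> C"
      have "norm (twisted_log (\<lambda>p. Z x p ^ j) (of_nat j * s))
          \<le> total_weight \<sigma> * 2 powr (\<sigma> - Re (of_nat j * s))"
        using unimodular_power[OF Z] ge[OF s] \<sigma> by (intro norm_twisted_log_decay) auto
      also have "\<dots> \<le> total_weight \<sigma> * 2 powr 0"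
        using ge[OF s] by (intro mult_left_mono powr_mono total_weight_nonneg) auto
      finally show "twisted_log (\<lambda>p. Z x p ^ j) (of_nat j * s) \<in> cball 0 (total_weight \<sigma>)"
        by simp
    qed
  qed auto
  have "uniform_limit C (\<lambda>x s. \<Sum>j\<in>J. exp (twisted_log (\<lambda>p. Z x p ^ j) (of_nat j * s)))
      (\<lambda>s. \<Sum>j\<in>J. exp (twisted_log (\<lambda>p. z p ^ j) (of_nat j * s))) F" if "J \<subseteq> {1..N}" for J
    using finite_subset[OF that finite_atLeastAtMost] that
  proof (induction J rule: finite_induct)
    case (insert j J)
    thus ?case
      using uniform_limit_add[OF ul[of j] insert.IH] by simp
  qed (simp add: uniform_limit_const)
  thus ?thesis
    unfolding twisted_sum_def[abs_def] by simp
qed simp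

text \<open>
  If the untwisted sum had finitely many zeros, its vertical shifts by large \<open>\<tau>\<close> would have no zero in
  the quarter-plane \<open>S\<close> containing \<open>s0\<close>. Some of these shifts converge to the sum twisted by \<open>z\<close>, which
  could then not vanish at \<open>s0\<close> by Hurwitz's theorem.
\<close>
lemma infinitely_many_zeros_of_twisted_zero:
  assumes z: "unimodular z" and s0: "Re s0 > 1" and zero: "twisted_sum N z s0 = 0" and N: "N \<ge> 1"
  shows "infinite {s. Re s > 1 \<and> twisted_sum N (\<lambda>_. 1) s = 0}"
proof
  assume fin: "finite {s. Re s > 1 \<and> twisted_sum N (\<lambda>_. 1) s = 0}"
  define B where "B = Max (insert 0 (Im ` {s. Re s > 1 \<and> twisted_sum N (\<lambda>_. 1) s = 0}))"
  have B: "Im s \<le> B" if "Re s > 1" "twisted_sum N (\<lambda>_. 1) s = 0" for s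
    unfolding B_def using fin that by (intro Max_ge) auto
  obtain \<tau> where \<tau>: "\<And>m. \<tau> m \<ge> real m"
      "\<And>p. prime p \<Longrightarrow> (\<lambda>m. of_nat p powr (- (\<i> * of_real (\<tau> m)))) \<longlonglongrightarrow> z p"
    using vertical_shifts_approach_any_twist z by blast
  obtain M :: nat where M: "real M > B - Im s0 + 1"
    using reals_Archimedean2 by blast
  \<comment> \<open>The value 1 off the primes never enters a sum; it only keeps \<open>Z m\<close> unimodular at 0.\<close>
  define Z where "Z m p = (if prime p then of_nat p powr (- (\<i> * of_real (\<tau> (m + M)))) else 1 :: complex)" for m p
  have Z: "unimodular (Z m)" for m
    using prime_gt_0_nat by (auto simp: Z_def norm_of_nat_powr)
  have limZ: "(\<lambda>m. Z m p) \<longlonglongrightarrow> z p" if "prime p" for p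
    using LIMSEQ_ignore_initial_segment[OF \<tau>(2)[OF that], of M] that by (simp add: Z_def)
  have shift: "twisted_sum N (Z m) s = twisted_sum N (\<lambda>_. 1) (s + \<i> * of_real (\<tau> (m + M)))" for m s
    by (subst twisted_sum_vertical_shift, unfold twisted_sum_def twisted_log_def,
        intro sum.cong arg_cong[where f = exp] infsum_cong refl) (auto simp: twisted_term_def Z_def)
  define S where "S = {s. Re s > 1 \<and> Im s > Im s0 - 1}"
  have S_eq: "S = {s. Re s > 1} \<inter> {s. Im s > Im s0 - 1}"
    by (auto simp: S_def)
  have "open S" "convex S"
    unfolding S_eq by (auto intro!: open_Int convex_Int open_halfspace_Re_gt open_halfspace_Im_gt
        convex_halfspace_Re_gt convex_halfspace_Im_gt)
  have "twisted_sum N z s0 \<noteq> 0"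
  proof (rule Hurwitz_no_zeros[of S "\<lambda>m. twisted_sum N (Z m)" "twisted_sum N z"])
    show "connected S"
      using \<open>convex S\<close> by (rule convex_connected)
    show "twisted_sum N (Z m) holomorphic_on S" for m
      by (rule holomorphic_on_subset[OF twisted_sum_holomorphic[OF Z]]) (auto simp: S_def)
    show "twisted_sum N z holomorphic_on S"
      by (rule holomorphic_on_subset[OF twisted_sum_holomorphic[OF z]]) (auto simp: S_def)
    show "uniform_limit C (\<lambda>m. twisted_sum N (Z m)) (twisted_sum N z) sequentially"
      if "compact C" "C \<subseteq> S" for C
      using that by (intro twisted_sum_uniform_limit limZ Z z) (auto simp: S_def)
    show "\<not> twisted_sum N z constant_on S"
    proof
      assume "twisted_sum N z constant_on S"
      then obtain c where c: "\<And>s. s \<in> S \<Longrightarrow> twisted_sum N z s = c"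
        by (auto simp: constant_on_def)
      have "s0 \<in> S" "\<And>n. s0 + of_nat n \<in> S"
        using s0 by (auto simp: S_def)
      hence "twisted_sum N z (s0 + of_nat n) = 0" for n
        using c zero by metis
      hence "(\<lambda>n::nat. 0) \<longlonglongrightarrow> (of_nat N :: complex)"
        using twisted_sum_at_infinity[OF z s0, of N] by simp
      thus False
        using N by (simp add: LIMSEQ_const_iff)
    qed
    show "twisted_sum N (Z m) s \<noteq> 0" if s: "s \<in> S" for m s
    proof
      assume "twisted_sum N (Z m) s = 0"
      hence "Im (s + \<i> * of_real (\<tau> (m + M))) \<le> B"
        using s by (intro B) (auto simp: S_def shift)
      thus False
        using s M \<tau>(1)[of "m + M"] by (simp add: S_def)
    qed
    show "s0 \<in> S"
      using s0 by (simp add: S_def)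
  qed fact
  thus False
    using zero by contradiction
qed

section \<open>Existence of a twisted zero\<close>
lemma weight_prime_le:
  assumes p: "prime p" and \<sigma>: "\<sigma> \<ge> 1"
  shows "weight \<sigma> (p, 1) \<le> K"
proof -
  have p1: "real p > 1"
    using prime_gt_1_nat[OF p] by simp
  have "weight \<sigma> (p, 1) \<le> K * real p powr \<theta> / real p powr \<sigma>"
    using b_bound[OF p, of 1] by (simp add: weight_def divide_right_mono)
  also have "\<dots> = K * real p powr (\<theta> - \<sigma>)"
    by (simp add: powr_diff)
  also have "\<dots> \<le> K * real p powr 0"
    using p1 \<theta>_less \<sigma> K_pos by (intro mult_left_mono powr_mono) auto
  finally show ?thesis
    using p1 by simp
qed

text \<open>
  With \<open>\<eta> = 1 - \<theta> > 1/2\<close> the weight of \<open>p ^ k\<close> is at most \<open>K p powr (- k\<eta>)\<close>. Of the \<open>k \<ge> 2\<close> factors \<open>p powr (-\<eta>)\<close>, two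
  make the sum over \<open>p\<close> converge, and the others are at most \<open>2 powr (-\<eta>) < 1\<close> and make the sum over
  \<open>k\<close> converge.
\<close>
lemma higher_powers_bounded:
  obtains H where "H \<ge> 0"
    and "\<And>\<sigma>. \<sigma> > 1 \<Longrightarrow> (\<Sum>\<^sub>\<infinity>i\<in>{i \<in> prime_exponents. snd i \<ge> 2}. weight \<sigma> i) \<le> H"
proof -
  define \<eta> where "\<eta> = 1 - \<theta>"
  define r where "r = 2 powr (- \<eta>)"
  have \<eta>: "\<eta> > 1 / 2"
    using \<theta>_less by (simp add: \<eta>_def)
  have r: "0 < r" "r < 1"
    using \<eta> powr_less_mono[of "-\<eta>" 0 "2::real"] by (auto simp: r_def)
  define h where "h = (\<lambda>i. K * 2 powr (2 * \<eta>) * (real (fst i) powr (- 2 * \<eta>) * r ^ snd i))"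
  have sm_p: "(\<lambda>p. real p powr (- 2 * \<eta>)) summable_on UNIV"
    using \<eta> summable_real_powr_iff[of "- 2 * \<eta>"] by (intro summable_nonneg_imp_summable_on) auto
  have sm_k: "(\<lambda>k. r ^ k) summable_on UNIV"
    using r by (intro summable_nonneg_imp_summable_on summable_geometric) auto
  have "(\<lambda>i. norm (real (fst i) powr (- 2 * \<eta>) * r ^ snd i)) summable_on (UNIV \<times> UNIV)"
    using sm_p sm_k r by (intro has_sum_product_abs(2)[OF has_sum_infsum[OF sm_p] _ has_sum_infsum[OF sm_k]]) auto
  hence "(\<lambda>i. real (fst i) powr (- 2 * \<eta>) * r ^ snd i) summable_on UNIV"
    using r by (simp add: abs_mult power_abs)
  hence sm_h: "h summable_on UNIV"
    unfolding h_def by (rule summable_on_cmult_right)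
  have h_nonneg: "h i \<ge> 0" for i
    using K_pos r by (simp add: h_def)
  show ?thesis
  proof (rule that[of "infsum h UNIV"])
    show "infsum h UNIV \<ge> 0"
      by (intro infsum_nonneg h_nonneg)
    fix \<sigma> :: real assume \<sigma>: "\<sigma> > 1"
    have "weight \<sigma> i \<le> h i" if i: "i \<in> prime_exponents" "snd i \<ge> 2" for i
    proof -
      obtain p k where pk: "i = (p, k)"
        by (cases i)
      have p: "prime p" "real p \<ge> 2" "k \<ge> 2"
        using i prime_ge_2_nat[of p] by (auto simp: pk)
      have "weight \<sigma> i \<le> K * real p powr (real k * \<theta>) / real p powr (real k * \<sigma>)"
        using b_bound[of p k] p by (simp add: weight_def pk divide_right_mono)
      also have "\<dots> = K * real p powr (real k * (\<theta> - \<sigma>))"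
        by (simp add: powr_diff algebra_simps)
      also have "\<dots> \<le> K * real p powr (real k * (- \<eta>))"
        using p \<sigma> K_pos by (intro mult_left_mono powr_mono) (auto simp: \<eta>_def)
      also have "real k * (- \<eta>) = - 2 * \<eta> + real (k - 2) * (- \<eta>)"
        using p by (simp add: of_nat_diff algebra_simps)
      also have "K * real p powr (- 2 * \<eta> + real (k - 2) * (- \<eta>)) =
          K * (real p powr (- 2 * \<eta>) * real p powr (real (k - 2) * (- \<eta>)))"
        by (simp only: powr_add)
      also have "\<dots> \<le> K * (real p powr (- 2 * \<eta>) * 2 powr (real (k - 2) * (- \<eta>)))"
        using p K_pos \<eta> by (intro mult_left_mono powr_mono2') auto
      also have "2 powr (real (k - 2) * (- \<eta>)) = 2 powr (2 * \<eta>) * 2 powr (real k * (- \<eta>))"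
        using p by (simp add: powr_add[symmetric] of_nat_diff algebra_simps)
      also have "2 powr (real k * (- \<eta>)) = r ^ k"
        by (simp add: r_def powr_power)
      finally show ?thesis
        by (simp add: h_def pk mult_ac)
    qed
    moreover have "weight \<sigma> summable_on {i \<in> prime_exponents. snd i \<ge> 2}"
      by (rule summable_on_subset_banach[OF weight_summable[OF \<sigma>]]) auto
    ultimately show "(\<Sum>\<^sub>\<infinity>i\<in>{i \<in> prime_exponents. snd i \<ge> 2}. weight \<sigma> i) \<le> infsum h UNIV"
      using sm_h h_nonneg by (intro infsum_mono_neutral) auto
  qed
qed

lemma prime_weights_summable:
  assumes "\<sigma> > 1"
  shows "(\<lambda>p. weight \<sigma> (p, 1)) summable_on {p. prime p}"
proof -
  have "weight \<sigma> summable_on ((\<lambda>p. (p, 1)) ` {p. prime p})"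
    by (rule summable_on_subset_banach[OF weight_summable[OF assms]]) auto
  thus ?thesis
    by (subst (asm) summable_on_reindex) (auto simp: inj_on_def o_def)
qed

lemma continuous_on_twisted_log:
  assumes Z: "\<And>w. unimodular (Z w)" and cont: "\<And>p. continuous_on A (\<lambda>w. Z w p)" and s: "Re s > 1"
  shows "continuous_on A (\<lambda>w. twisted_log (Z w) s)"
  unfolding continuous_on_def
proof
  fix w assume "w \<in> A"
  thus "((\<lambda>w. twisted_log (Z w) s) \<longlongrightarrow> twisted_log (Z w) s) (at w within A)"
    using Z cont s by (intro twisted_log_tendsto) (auto simp: continuous_on_def)
qed

text \<open>
  The radius \<open>R\<close> is the total of all bounded errors: \<open>2K\<close> from representing \<open>w\<close> by the primes in the finite
  set \<open>A\<close>, at most 1 from the other primes, \<open>H\<close> from the higher prime powers, \<open>C\<close> from the logarithm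
  of the remaining summands, and \<open>\<pi>\<close>. None of them depends on \<open>\<sigma>\<close>, so \<open>\<sigma>\<close> can be chosen
  afterwards, so close to 1 that the primes reach the whole disc of radius \<open>R\<close>.
\<close>
lemma twisted_zero_exists:
  assumes diverges: "filterlim (\<lambda>\<sigma>. \<Sum>\<^sub>\<infinity>p\<in>{p. prime p}. weight \<sigma> (p, 1)) at_top (at_right 1)"
    and C: "C \<ge> 0"
    and bounded_log: "\<And>\<sigma> Z R. \<sigma> > 1 \<Longrightarrow> (\<And>w. unimodular (Z w)) \<Longrightarrow>
        (\<And>p. continuous_on (cball (0::complex) R) (\<lambda>w. Z w p)) \<Longrightarrow>
        \<exists>l. continuous_on (cball 0 R) l \<and> (\<forall>w\<in>cball 0 R. norm (l w) \<le> C \<and>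
          exp (l w) = (\<Sum>j=2..N. exp (twisted_log (\<lambda>p. Z w p ^ j) (of_nat j * of_real \<sigma>))))"
    and N: "N \<ge> 1"
  obtains z \<sigma> where "unimodular z" "\<sigma> > 1" "twisted_sum N z (of_real \<sigma>) = 0"
proof -
  obtain H where H: "H \<ge> 0"
      "\<And>\<sigma>. \<sigma> > 1 \<Longrightarrow> (\<Sum>\<^sub>\<infinity>i\<in>{i \<in> prime_exponents. snd i \<ge> 2}. weight \<sigma> i) \<le> H"
    using higher_powers_bounded by blast
  define R where "R = 2 * K + (1 + H) + C + pi"
  have R: "R > 0"
    using K_pos H(1) C pi_gt_zero by (simp add: R_def add_nonneg_pos)
  define S where "S \<sigma> = (\<Sum>\<^sub>\<infinity>p\<in>{p. prime p}. weight \<sigma> (p, 1))" for \<sigma>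
  have "\<forall>\<^sub>F \<sigma> in at_right 1. S \<sigma> \<ge> 2 * R + K + 1 \<and> \<sigma> > 1"
    using diverges unfolding filterlim_at_top S_def
    by (intro eventually_conj eventually_at_right_less) auto
  then obtain \<sigma> where \<sigma>: "S \<sigma> \<ge> 2 * R + K + 1" "\<sigma> > 1"
    using eventually_happens[of _ "at_right (1::real)"] by (auto simp: trivial_limit_at_right_real)
  obtain A where A: "finite A" "A \<subseteq> {p. prime p}" "dist (\<Sum>p\<in>A. weight \<sigma> (p, 1)) (S \<sigma>) \<le> 1"
    using infsum_finite_approximation[OF prime_weights_summable[OF \<sigma>(2)], of 1] unfolding S_def by auto
  define c where "c p = b p / of_nat p powr of_real \<sigma>" for p
  have norm_c: "norm (c p) = weight \<sigma> (p, 1)" for p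
    by (simp add: c_def weight_def norm_divide norm_of_nat_powr)
  have c_le: "norm (c p) \<le> K" if "p \<in> A" for p
    unfolding norm_c using that A(2) \<sigma>(2) by (intro weight_prime_le) auto
  have c_sum: "(\<Sum>p\<in>A. norm (c p)) \<ge> 2 * R + K"
    using A(3) \<sigma>(1) by (simp add: norm_c dist_real_def)
  obtain Z :: "complex \<Rightarrow> nat \<Rightarrow> complex" where "(\<forall>w p. norm (Z w p) = 1) \<and>
      (\<forall>p. continuous_on (cball 0 R) (\<lambda>w. Z w p)) \<and>
      (\<forall>w\<in>cball 0 R. norm ((\<Sum>p\<in>A. c p * Z w p) - w) \<le> 2 * K)"
    using unimodular_sums_cover_disc[OF A(1) c_le less_imp_le[OF K_pos] R c_sum] ..
  hence Z: "norm (Z w p) = 1" "continuous_on (cball 0 R) (\<lambda>w. Z w p)"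
      "w \<in> cball 0 R \<Longrightarrow> norm ((\<Sum>p\<in>A. c p * Z w p) - w) \<le> 2 * K" for w p
    by blast+
  have "\<exists>l. continuous_on (cball 0 R) l \<and> (\<forall>w\<in>cball 0 R. norm (l w) \<le> C \<and>
      exp (l w) = (\<Sum>j=2..N. exp (twisted_log (\<lambda>p. Z w p ^ j) (of_nat j * of_real \<sigma>))))"
    by (rule bounded_log[OF \<sigma>(2) _ Z(2)]) (simp add: Z(1))
  then obtain l where l: "continuous_on (cball 0 R) l"
      "\<And>w. w \<in> cball 0 R \<Longrightarrow> norm (l w) \<le> C"
      "\<And>w. w \<in> cball 0 R \<Longrightarrow>
        exp (l w) = (\<Sum>j=2..N. exp (twisted_log (\<lambda>p. Z w p ^ j) (of_nat j * of_real \<sigma>)))"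
    by blast
  have main_part: "norm (twisted_log (Z w) (of_real \<sigma>) - (\<Sum>p\<in>A. c p * Z w p)) \<le> 1 + H" for w
  proof -
    define T where "T = (\<lambda>p. (p, 1::nat)) ` A"
    have T: "finite T" "T \<subseteq> prime_exponents"
      using A by (auto simp: T_def)
    have Zw: "unimodular (Z w)"
      using Z(1) by simp
    have "(\<Sum>i\<in>T. twisted_term (Z w) (of_real \<sigma>) i) = (\<Sum>p\<in>A. c p * Z w p)"
      unfolding T_def by (subst sum.reindex) (auto simp: inj_on_def twisted_term_def c_def)
    hence 1: "(twisted_term (Z w) (of_real \<sigma>) has_sum
        (twisted_log (Z w) (of_real \<sigma>) - (\<Sum>p\<in>A. c p * Z w p))) (prime_exponents - T)"
      using has_sum_Diff[OF twisted_log_has_sum[OF Zw, of "of_real \<sigma>"] has_sum_finite[OF T(1)] T(2)] \<sigma>(2)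
      by simp
    define U where "U = (\<lambda>p. (p, 1::nat)) ` ({p. prime p} - A)"
    define V where "V = {i \<in> prime_exponents. snd i \<ge> 2}"
    have UV: "prime_exponents - T = U \<union> V" "U \<inter> V = {}"
      by (auto simp: T_def U_def V_def image_iff)
    have "((\<lambda>p. weight \<sigma> (p, 1)) has_sum (S \<sigma> - (\<Sum>p\<in>A. weight \<sigma> (p, 1)))) ({p. prime p} - A)"
      unfolding S_def
      by (rule has_sum_Diff[OF has_sum_infsum[OF prime_weights_summable[OF \<sigma>(2)]] has_sum_finite[OF A(1)] A(2)])
    hence U: "(weight \<sigma> has_sum (S \<sigma> - (\<Sum>p\<in>A. weight \<sigma> (p, 1)))) U"
      unfolding U_def by (subst has_sum_reindex) (auto simp: inj_on_def o_def)
    have "weight \<sigma> summable_on V"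
      by (rule summable_on_subset_banach[OF weight_summable[OF \<sigma>(2)]]) (auto simp: V_def)
    hence V: "(weight \<sigma> has_sum infsum (weight \<sigma>) V) V"
      by (rule has_sum_infsum)
    have 2: "(weight \<sigma> has_sum (S \<sigma> - (\<Sum>p\<in>A. weight \<sigma> (p, 1)) + infsum (weight \<sigma>) V)) (prime_exponents - T)"
      unfolding UV(1) by (rule has_sum_Un_disjoint[OF U V UV(2)])
    have "norm (twisted_log (Z w) (of_real \<sigma>) - (\<Sum>p\<in>A. c p * Z w p))
        \<le> S \<sigma> - (\<Sum>p\<in>A. weight \<sigma> (p, 1)) + infsum (weight \<sigma>) V"
      by (rule norm_infsum_le[OF 1 2]) (simp add: norm_twisted_term Z(1))
    also have "\<dots> \<le> 1 + H"
      using A(3) H(2)[OF \<sigma>(2)] by (simp add: V_def dist_real_def)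
    finally show ?thesis .
  qed
  \<comment> \<open>The fixed points of \<open>g\<close> are the solutions of \<open>twisted_log (Z w) \<sigma> = l w + \<pi>i\<close>.\<close>
  define g where "g w = w - twisted_log (Z w) (of_real \<sigma>) + l w + \<i> * of_real pi" for w
  have "continuous_on (cball 0 R) (\<lambda>w. twisted_log (Z w) (of_real \<sigma>))"
    using Z \<sigma>(2) by (intro continuous_on_twisted_log) auto
  hence cont_g: "continuous_on (cball 0 R) g"
    unfolding g_def by (intro continuous_intros l(1))
  have "g w \<in> cball 0 R" if w: "w \<in> cball 0 R" for w
  proof -
    define m where "m = (\<Sum>p\<in>A. c p * Z w p)"
    have "g w = (w - m) + (m - twisted_log (Z w) (of_real \<sigma>)) + l w + \<i> * of_real pi"
      by (simp add: g_def)
    also have "norm \<dots> \<le> norm (w - m) + norm (m - twisted_log (Z w) (of_real \<sigma>)) + norm (l w) + norm (\<i> * of_real pi)"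
      by (intro norm_triangle_le add_mono order_refl norm_triangle_ineq)
    also have "\<dots> \<le> 2 * K + (1 + H) + C + pi"
      using Z(3)[OF w] main_part[of w] l(2)[OF w]
      by (intro add_mono) (simp_all add: m_def norm_minus_commute norm_mult)
    finally show ?thesis
      by (simp add: R_def)
  qed
  then obtain w where w: "w \<in> cball 0 R" "g w = w"
    using brouwer_ball[OF R cont_g] by blast
  have "twisted_log (Z w) (of_real \<sigma>) = l w + \<i> * of_real pi"
    using w(2) by (simp add: g_def algebra_simps)
  hence "exp (twisted_log (Z w) (of_real \<sigma>)) = - exp (l w)"
    by (simp add: exp_add)
  moreover have "twisted_sum N (Z w) (of_real \<sigma>) = exp (twisted_log (Z w) (of_real \<sigma>)) + exp (l w)"
    unfolding twisted_sum_def l(3)[OF w(1)] sum.atLeast_Suc_atMost[OF N]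
    by (simp add: numeral_2_eq_2)
  ultimately have "twisted_sum N (Z w) (of_real \<sigma>) = 0"
    by simp
  thus ?thesis
    using that[of "Z w" \<sigma>] Z(1) \<sigma>(2) by blast
qed

lemma norm_twisted_log_multiple_le:
  assumes z: "unimodular z" and j: "j \<ge> 2" and \<sigma>: "\<sigma> > 1"
  shows "norm (twisted_log z (of_nat j * of_real \<sigma>)) \<le> total_weight 2 * 2 powr (2 - real j)"
proof -
  have "real j * \<sigma> \<ge> real j * 1"
    using \<sigma> by (intro mult_left_mono) auto
  hence ge: "real j * \<sigma> \<ge> real j"
    by simp
  have "norm (twisted_log z (of_nat j * of_real \<sigma>)) \<le> total_weight 2 * 2 powr (2 - real j * \<sigma>)"
    using norm_twisted_log_decay[OF z, of 2 "of_nat j * of_real \<sigma>"] ge j by simp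
  also have "\<dots> \<le> total_weight 2 * 2 powr (2 - real j)"
    using ge by (intro mult_left_mono powr_mono total_weight_nonneg) auto
  finally show ?thesis .
qed

lemma norm_twisted_log_multiple_le':
  assumes z: "unimodular z" and j: "j \<ge> 2" and \<sigma>: "\<sigma> > 1"
  shows "norm (twisted_log z (of_nat j * of_real \<sigma>)) \<le> total_weight 2"
proof -
  have "total_weight 2 * 2 powr (2 - real j) \<le> total_weight 2 * 2 powr 0"
    using j by (intro mult_left_mono powr_mono total_weight_nonneg) auto
  thus ?thesis
    using norm_twisted_log_multiple_le[OF assms] by simp
qed

lemma Re_multiple_gt_1: "j \<ge> 1 \<Longrightarrow> \<sigma> > 1 \<Longrightarrow> Re (of_nat j * of_real \<sigma>) > 1"
  using mult_mono[of 1 "real j" \<sigma> \<sigma>] less_le_trans[of 1 \<sigma> "real j * \<sigma>"] by simp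

lemma twisted_zero_two_terms:
  assumes diverges: "filterlim (\<lambda>\<sigma>. \<Sum>\<^sub>\<infinity>p\<in>{p. prime p}. weight \<sigma> (p, 1)) at_top (at_right 1)"
  obtains z \<sigma> where "unimodular z" "\<sigma> > 1" "twisted_sum 2 z (of_real \<sigma>) = 0"
proof (rule twisted_zero_exists[OF diverges total_weight_nonneg[of 2]])
  fix \<sigma> :: real and Z :: "complex \<Rightarrow> nat \<Rightarrow> complex" and R :: real
  assume \<sigma>: "\<sigma> > 1" and Z: "\<And>w. unimodular (Z w)" and cont: "\<And>p. continuous_on (cball 0 R) (\<lambda>w. Z w p)"
  define l where "l w = twisted_log (\<lambda>p. Z w p ^ 2) (of_nat 2 * of_real \<sigma>)" for w
  have "continuous_on (cball 0 R) l"
    unfolding l_def using \<sigma> Z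
    by (intro continuous_on_twisted_log Re_multiple_gt_1 continuous_on_power cont) (auto simp: norm_power)
  moreover have "norm (l w) \<le> total_weight 2" for w
    unfolding l_def using \<sigma> Z by (intro norm_twisted_log_multiple_le') (auto simp: norm_power)
  ultimately show "\<exists>l. continuous_on (cball 0 R) l \<and> (\<forall>w\<in>cball 0 R. norm (l w) \<le> total_weight 2 \<and>
      exp (l w) = (\<Sum>j=2..2. exp (twisted_log (\<lambda>p. Z w p ^ j) (of_nat j * of_real \<sigma>))))"
    by (intro exI[of _ l]) (simp add: l_def)
qed (use that in auto)

text \<open>
  The principal logarithm is continuous on the right half-plane, and it is bounded because the sum stays
  away from both 0 and infinity.
\<close>
lemma twisted_zero_if_Re_pos:
  assumes diverges: "filterlim (\<lambda>\<sigma>. \<Sum>\<^sub>\<infinity>p\<in>{p. prime p}. weight \<sigma> (p, 1)) at_top (at_right 1)"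
    and N: "N \<ge> 1" and \<delta>: "\<delta> > 0"
    and Re_pos: "\<And>z \<sigma>. unimodular z \<Longrightarrow> \<sigma> > 1 \<Longrightarrow>
      Re (\<Sum>j=2..N. exp (twisted_log (\<lambda>p. z p ^ j) (of_nat j * of_real \<sigma>))) \<ge> \<delta>"
  obtains z \<sigma> where "unimodular z" "\<sigma> > 1" "twisted_sum N z (of_real \<sigma>) = 0"
proof (rule twisted_zero_exists[OF diverges _ _ N])
  define B where "B = real N * exp (total_weight 2)"
  define C where "C = \<bar>ln \<delta>\<bar> + B + pi"
  have B: "B \<ge> 0"
    by (simp add: B_def)
  show "C \<ge> 0"
    using B by (simp add: C_def)
  fix \<sigma> :: real and Z :: "complex \<Rightarrow> nat \<Rightarrow> complex" and R :: real
  assume \<sigma>: "\<sigma> > 1" and Z: "\<And>w. unimodular (Z w)" and cont: "\<And>p. continuous_on (cball 0 R) (\<lambda>w. Z w p)"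
  define r where "r w = (\<Sum>j=2..N. exp (twisted_log (\<lambda>p. Z w p ^ j) (of_nat j * of_real \<sigma>)))" for w
  have r: "Re (r w) \<ge> \<delta>" for w
    unfolding r_def by (rule Re_pos[OF Z \<sigma>])
  have norm_r: "\<delta> \<le> norm (r w)" "norm (r w) \<le> B" for w
  proof -
    show "\<delta> \<le> norm (r w)"
      using r[of w] complex_Re_le_cmod[of "r w"] by linarith
    have "norm (r w) \<le> (\<Sum>j=2..N. exp (total_weight 2))"
      unfolding r_def
    proof (rule sum_norm_le)
      fix j assume j: "j \<in> {2..N}"
      have "norm (exp (twisted_log (\<lambda>p. Z w p ^ j) (of_nat j * of_real \<sigma>)))
          \<le> exp (norm (twisted_log (\<lambda>p. Z w p ^ j) (of_nat j * of_real \<sigma>)))"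
        by (rule norm_exp)
      also have "\<dots> \<le> exp (total_weight 2)"
        using norm_twisted_log_multiple_le'[OF unimodular_power[OF Z] _ \<sigma>] j by simp
      finally show "norm (exp (twisted_log (\<lambda>p. Z w p ^ j) (of_nat j * of_real \<sigma>))) \<le> exp (total_weight 2)" .
    qed
    also have "\<dots> \<le> B"
      by (simp add: B_def)
    finally show "norm (r w) \<le> B" .
  qed
  have r_nz: "r w \<noteq> 0" for w
    using norm_r(1)[of w] \<delta> by auto
  have "continuous_on (cball 0 R) r"
    unfolding r_def using \<sigma> Z
    by (intro continuous_on_sum continuous_on_exp continuous_on_twisted_log Re_multiple_gt_1
        continuous_on_power cont) (auto simp: norm_power)
  moreover have "r w \<notin> \<real>\<^sub>\<le>\<^sub>0" for w
    using r[of w] \<delta> by (auto simp: complex_nonpos_Reals_iff)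
  ultimately have "continuous_on (cball 0 R) (\<lambda>w. Ln (r w))"
    by (intro continuous_on_Ln') auto
  moreover have "norm (Ln (r w)) \<le> C" for w
  proof -
    have "norm (Ln (r w)) \<le> \<bar>ln (norm (r w))\<bar> + \<bar>Im (Ln (r w))\<bar>"
      using cmod_le[of "Ln (r w)"] r_nz[of w] by simp
    also have "\<bar>Im (Ln (r w))\<bar> \<le> pi"
      using mpi_less_Im_Ln[OF r_nz[of w]] Im_Ln_le_pi[OF r_nz[of w]] by linarith
    also have "\<bar>ln (norm (r w))\<bar> \<le> \<bar>ln \<delta>\<bar> + B"
    proof -
      have "ln \<delta> \<le> ln (norm (r w))"
        using ln_le_cancel_iff[OF \<delta>, of "norm (r w)"] norm_r(1)[of w] r_nz[of w] by simp
      moreover have "ln (norm (r w)) \<le> norm (r w) - 1"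
        using r_nz[of w] by (intro ln_le_minus_one) auto
      ultimately show ?thesis
        using norm_r(2)[of w] B by linarith
    qed
    finally show ?thesis
      by (simp add: C_def)
  qed
  ultimately show "\<exists>l. continuous_on (cball 0 R) l \<and> (\<forall>w\<in>cball 0 R. norm (l w) \<le> C \<and>
      exp (l w) = (\<Sum>j=2..N. exp (twisted_log (\<lambda>p. Z w p ^ j) (of_nat j * of_real \<sigma>))))"
    using r_nz by (intro exI[of _ "\<lambda>w. Ln (r w)"]) (simp add: r_def[symmetric])
qed (use that in auto)

text \<open>
  For \<open>j \<ge> J\<close> the twisted logarithm at \<open>j\<sigma>\<close> has norm at most \<open>1/2\<close>, so its exponential has real
  part at least \<open>1/4\<close>. The finitely many earlier summands are bounded, and are outweighed
  once \<open>N\<close> is large.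
\<close>
lemma twisted_tail_Re_pos_eventually:
  obtains N0 where "\<And>N z \<sigma>. N \<ge> N0 \<Longrightarrow> unimodular z \<Longrightarrow> \<sigma> > 1 \<Longrightarrow>
      Re (\<Sum>j=2..N. exp (twisted_log (\<lambda>p. z p ^ j) (of_nat j * of_real \<sigma>))) \<ge> 1"
proof -
  define W where "W = total_weight 2"
  have "(\<lambda>j. W * (4 * (1 / 2) ^ j)) \<longlonglongrightarrow> W * (4 * 0)"
    by (intro tendsto_intros LIMSEQ_power_zero) auto
  hence "\<forall>\<^sub>F j in sequentially. W * (4 * (1 / 2) ^ j) < 1 / 2"
    by (rule order_tendstoD) simp
  then obtain J where J: "\<And>j. j \<ge> J \<Longrightarrow> W * (4 * (1 / 2) ^ j) < 1 / 2"
    by (auto simp: eventually_sequentially)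
  define E where "E = exp W + 1 / 4"
  obtain N0 :: nat where N0: "real N0 \<ge> 4 * (1 + real J * E) + 1"
    using real_arch_simple by blast
  show ?thesis
  proof (rule that[of "max N0 2"])
    fix N z \<sigma> assume N: "N \<ge> max N0 2" and z: "unimodular z" and \<sigma>: "\<sigma> > (1::real)"
    define f where "f j = exp (twisted_log (\<lambda>p. z p ^ j) (of_nat j * of_real \<sigma>))" for j
    have f: "Re (f j) \<ge> 1 / 4 - (if j < J then E else 0)" if j: "j \<ge> 2" for j
    proof (cases "j < J")
      case True
      have "norm (f j) \<le> exp (norm (twisted_log (\<lambda>p. z p ^ j) (of_nat j * of_real \<sigma>)))"
        unfolding f_def by (rule norm_exp)
      also have "\<dots> \<le> exp W"
        using norm_twisted_log_multiple_le'[OF unimodular_power[OF z] j \<sigma>] by (simp add: W_def)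
      finally have "Re (f j) \<ge> - exp W"
        using abs_Re_le_cmod[of "f j"] by linarith
      thus ?thesis
        using True by (simp add: E_def)
    next
      case False
      have "norm (twisted_log (\<lambda>p. z p ^ j) (of_nat j * of_real \<sigma>)) \<le> W * 2 powr (2 - real j)"
        unfolding W_def by (rule norm_twisted_log_multiple_le[OF unimodular_power[OF z] j \<sigma>])
      also have "2 powr (2 - real j) = 4 * (1 / 2) ^ j"
        by (simp add: powr_diff powr_realpow power_one_over)
      also have "W * (4 * (1 / 2) ^ j) \<le> 1 / 2"
        using J[of j] False by linarith
      finally have small: "norm (twisted_log (\<lambda>p. z p ^ j) (of_nat j * of_real \<sigma>)) \<le> 1 / 2" .
      have "norm (f j - 1) \<le> 3 / 2 * norm (twisted_log (\<lambda>p. z p ^ j) (of_nat j * of_real \<sigma>))"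
        unfolding f_def using small by (intro norm_exp_bounds) auto
      hence "norm (f j - 1) \<le> 3 / 4"
        using small by linarith
      thus ?thesis
        using abs_Re_le_cmod[of "f j - 1"] False by simp
    qed
    have "(\<Sum>j=2..N. if j < J then E else 0) = (\<Sum>j\<in>{2..N} \<inter> {..<J}. E)"
      by (subst sum.inter_restrict) auto
    also have "\<dots> \<le> (\<Sum>j<J. E)"
      by (intro sum_mono2) (auto simp: E_def intro: add_nonneg_nonneg)
    finally have few: "(\<Sum>j=2..N. if j < J then E else 0) \<le> real J * E"
      by simp
    have "real N0 \<le> real N"
      using N by simp
    hence "1 \<le> (real N - 1) / 4 - real J * E"
      using N0 by (simp add: field_simps)
    also have "\<dots> \<le> (real N - 1) / 4 - (\<Sum>j=2..N. if j < J then E else 0)"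
      using few by (rule diff_left_mono)
    also have "\<dots> = (\<Sum>j=2..N. 1 / 4 - (if j < J then E else 0))"
      using N by (simp add: sum_subtractf of_nat_diff)
    also have "\<dots> \<le> (\<Sum>j=2..N. Re (f j))"
      by (intro sum_mono f) auto
    also have "\<dots> = Re (\<Sum>j=2..N. f j)"
      by simp
    finally show "Re (\<Sum>j=2..N. exp (twisted_log (\<lambda>p. z p ^ j) (of_nat j * of_real \<sigma>))) \<ge> 1"
      unfolding f_def .
  qed
qed

lemma prime_power_series_eq: "prime_power_series b s = twisted_log (\<lambda>_. 1) s"
  unfolding prime_power_series_def twisted_log_def
  by (rule infsum_cong) (auto simp: twisted_term_def)

text \<open>
  A twist is a limit of vertical shifts, and \<open>L\<close> satisfies the bound on the whole line. This
  avoids twisting the Dirichlet series with coefficients \<open>a\<close>.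
\<close>
lemma twisted_exp_minus_1_le:
  assumes z: "unimodular z" and s: "Re s > 1"
    and le: "\<And>s'. Re s' = Re s \<Longrightarrow> norm (exp (twisted_log (\<lambda>_. 1) s') - 1) \<le> c"
  shows "norm (exp (twisted_log z s) - 1) \<le> c"
proof -
  obtain \<tau> where \<tau>: "\<And>p. prime p \<Longrightarrow> (\<lambda>m. of_nat p powr (- (\<i> * of_real (\<tau> m)))) \<longlonglongrightarrow> z p"
    using vertical_shifts_approach_any_twist z by blast
  define Z where "Z m p = (if prime p then of_nat p powr (- (\<i> * of_real (\<tau> m))) else 1 :: complex)" for m p
  have Z: "unimodular (Z m)" for m
    using prime_gt_0_nat by (auto simp: Z_def norm_of_nat_powr)
  have eq: "twisted_log (Z m) s = twisted_log (\<lambda>_. 1) (s + \<i> * of_real (\<tau> m))" for m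
    by (subst twisted_log_vertical_shift, unfold twisted_log_def, rule infsum_cong)
       (auto simp: twisted_term_def Z_def)
  have "(\<lambda>m. twisted_log (Z m) s) \<longlonglongrightarrow> twisted_log z s"
    using \<tau> Z s by (intro twisted_log_tendsto) (auto simp: Z_def)
  hence "(\<lambda>m. norm (exp (twisted_log (Z m) s) - 1)) \<longlonglongrightarrow> norm (exp (twisted_log z s) - 1)"
    by (intro tendsto_intros)
  moreover have "norm (exp (twisted_log (Z m) s) - 1) \<le> c" for m
    unfolding eq by (rule le) simp
  ultimately show ?thesis
    by (intro LIMSEQ_le_const2) auto
qed

section \<open>The coefficients of L and the zeros of the sum\<close>
lemma coefficients_from_exponent:
  assumes I: "\<And>s. Re s > 1 \<Longrightarrow> (\<lambda>n. norm (a n / of_nat n powr s)) summable_on {1..}"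
    and L_exp: "\<And>s. Re s > 1 \<Longrightarrow> dirichlet_series a s = exp (twisted_log (\<lambda>_. 1) s)"
  shows "a 1 = 1" and "prime p \<Longrightarrow> a p = b p"
proof -
  define \<beta> where "\<beta> i = b (fst i ^ snd i)" for i
  define Q where "Q i = fst i ^ snd i" for i :: "nat \<times> nat"
  have Q: "Q i \<ge> 2" if i: "i \<in> prime_exponents" for i
  proof -
    have "fst i ^ 1 \<le> fst i ^ snd i"
      using prime_exponents_pos[OF i] by (intro power_increasing) auto
    thus ?thesis
      using prime_exponents_pos(1)[OF i] by (simp add: Q_def)
  qed
  have a_term: "a n / of_nat n powr of_nat j = a n / of_nat n ^ j" if "j \<ge> 2" for n j :: nat
    using that by (simp add: powr_nat')
  have b_term: "twisted_term (\<lambda>_. 1) (of_nat j) i = \<beta> i / of_nat (Q i) ^ j"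
    if "j \<ge> 2" "i \<in> prime_exponents" for i j
    using prime_exponents_pos(1)[OF that(2)]
    by (simp add: twisted_term_def \<beta>_def Q_def power_mult flip: of_nat_mult)
  have sm_a: "(\<lambda>n. norm (a n / of_nat n ^ j)) summable_on {1..}" if "j \<ge> 2" for j
    using I[of "of_nat j"] that by (simp add: a_term)
  have sm_b: "(\<lambda>i. norm (\<beta> i / of_nat (Q i) ^ j)) summable_on prime_exponents" if "j \<ge> 2" for j
  proof -
    have "(\<lambda>i. norm (twisted_term (\<lambda>_. 1) (of_nat j) i)) summable_on prime_exponents"
      by (rule twisted_term_summable) (use that in auto)
    thus ?thesis
      by (rule iffD1[OF summable_on_cong, rotated]) (simp only: b_term[OF that])
  qed
  have eq: "(\<Sum>\<^sub>\<infinity>n\<in>{1..}. a n / of_nat n ^ j) = exp (\<Sum>\<^sub>\<infinity>i\<in>prime_exponents. \<beta> i / of_nat (Q i) ^ j)"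
    if j: "j \<ge> 2" for j
  proof -
    have "twisted_log (\<lambda>_. 1) (of_nat j) = (\<Sum>\<^sub>\<infinity>i\<in>prime_exponents. \<beta> i / of_nat (Q i) ^ j)"
      unfolding twisted_log_def by (rule infsum_cong) (simp only: b_term[OF j])
    thus ?thesis
      using L_exp[of "of_nat j"] j by (simp add: dirichlet_series_def a_term[OF j])
  qed
  show "a 1 = 1"
    by (rule exp_dirichlet_coefficients(1)[OF Q sm_a sm_b eq])
  show "a p = b p" if p: "prime p"
  proof -
    have only: "{i \<in> prime_exponents. Q i = p} = {(p, 1)}"
    proof (intro equalityI subsetI)
      fix i assume "i \<in> {i \<in> prime_exponents. Q i = p}"
      hence i: "i \<in> prime_exponents" "fst i ^ snd i = p"
        by (auto simp: Q_def)
      hence "snd i = 1"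
        using p by (metis prime_power_iff)
      thus "i \<in> {(p, 1)}"
        using i(2) by (cases i) auto
    qed (use p in \<open>auto simp: Q_def\<close>)
    have "a p = \<beta> (p, 1)"
      using exp_dirichlet_coefficients(2)[OF Q sm_a sm_b eq p only] by simp
    thus ?thesis
      by (simp add: \<beta>_def)
  qed
qed

end

theorem theorem1:
  fixes a b :: "nat \<Rightarrow> complex" and L :: "complex \<Rightarrow> complex" and K \<theta> :: real
  defines "L \<equiv> dirichlet_series a"
  assumes I: "\<And>s. Re s > 1 \<Longrightarrow> (\<lambda>n. norm (a n / of_nat n powr s)) summable_on {1..}"
    and II_conv: "\<And>s. Re s > 1 \<Longrightarrow>
      (\<lambda>(p, k). norm (b (p ^ k) / of_nat p powr (of_nat k * s)))
        summable_on ({p. prime p} \<times> {1..})"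
    and II_exp: "\<And>s. Re s > 1 \<Longrightarrow> L s = exp (prime_power_series b s)"
    and K: "K > 0" and \<theta>: "\<theta> < 1 / 2"
    and II_bound: "\<And>p k. prime p \<Longrightarrow> k \<ge> 1 \<Longrightarrow> norm (b (p ^ k)) \<le> K * real p powr (real k * \<theta>)"
    and III: "filterlim (\<lambda>\<sigma>::real. \<Sum>\<^sub>\<infinity>p\<in>{p. prime p}. norm (a p) * real p powr (-\<sigma>))
      at_top (at_right 1)"
  shows "infinite (zeros_right_of_1 (\<lambda>s. \<Sum>j=1..2. L (of_nat j * s))) \<and>
    (\<exists>N0::nat. \<forall>N\<ge>N0. infinite (zeros_right_of_1 (\<lambda>s. \<Sum>j=1..N. L (of_nat j * s)))) \<and>
    ((\<forall>n\<ge>2. norm (a n) \<le> real n powr (1 / 4)) \<longrightarrow>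
      (\<forall>N\<ge>2. infinite (zeros_right_of_1 (\<lambda>s. \<Sum>j=1..N. L (of_nat j * s)))))"
proof -
  interpret prime_power_exponent b K \<theta>
    by unfold_locales (use II_conv K \<theta> II_bound in auto)
  have L_exp: "L s = exp (twisted_log (\<lambda>_. 1) s)" if "Re s > 1" for s
    using II_exp[OF that] by (simp add: prime_power_series_eq)
  note coeffs = coefficients_from_exponent[of a, folded L_def, OF I L_exp]
  have diverges: "filterlim (\<lambda>\<sigma>. \<Sum>\<^sub>\<infinity>p\<in>{p. prime p}. weight \<sigma> (p, 1)) at_top (at_right 1)"
  proof -
    have "(\<Sum>\<^sub>\<infinity>p\<in>{p. prime p}. norm (a p) * real p powr (-\<sigma>)) = (\<Sum>\<^sub>\<infinity>p\<in>{p. prime p}. weight \<sigma> (p, 1))" for \<sigma>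
      by (intro infsum_cong) (simp add: weight_def coeffs(2) powr_minus_divide)
    thus ?thesis
      using III by simp
  qed
  have sum_eq: "(\<Sum>j=1..N. L (of_nat j * s)) = twisted_sum N (\<lambda>_. 1) s" if s: "Re s > 1" for N s
    unfolding twisted_sum_def
  proof (intro sum.cong refl)
    fix j assume "j \<in> {1..N}"
    hence "Re s \<le> Re (of_nat j * s)"
      using s by (intro Re_mult_nat_ge) auto
    thus "L (of_nat j * s) = exp (twisted_log (\<lambda>p. 1 ^ j) (of_nat j * s))"
      using s by (subst L_exp) (auto simp del: times_complex.sel)
  qed
  have zeros: "infinite (zeros_right_of_1 (\<lambda>s. \<Sum>j=1..N. L (of_nat j * s)))"
    if "unimodular z" "\<sigma> > 1" "twisted_sum N z (of_real \<sigma>) = 0" "N \<ge> 1" for N z \<sigma>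
  proof -
    have "infinite {s. Re s > 1 \<and> twisted_sum N (\<lambda>_. 1) s = 0}"
      using that by (intro infinitely_many_zeros_of_twisted_zero[of z "of_real \<sigma>"]) auto
    also have "{s. Re s > 1 \<and> twisted_sum N (\<lambda>_. 1) s = 0} = zeros_right_of_1 (\<lambda>s. \<Sum>j=1..N. L (of_nat j * s))"
      unfolding zeros_right_of_1_def using sum_eq by (intro Collect_cong) auto
    finally show ?thesis .
  qed
  have two: "infinite (zeros_right_of_1 (\<lambda>s. \<Sum>j=1..2. L (of_nat j * s)))"
    using twisted_zero_two_terms[OF diverges] zeros[of _ _ 2] by (metis one_le_numeral)
  have if_Re_pos: "infinite (zeros_right_of_1 (\<lambda>s. \<Sum>j=1..N. L (of_nat j * s)))"
    if N: "N \<ge> 1" and \<delta>: "\<delta> > 0" and Re_pos: "\<And>z \<sigma>. unimodular z \<Longrightarrow> \<sigma> > 1 \<Longrightarrow>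
      Re (\<Sum>j=2..N. exp (twisted_log (\<lambda>p. z p ^ j) (of_nat j * of_real \<sigma>))) \<ge> \<delta>" for N \<delta>
  proof -
    obtain z \<sigma> where "unimodular z" "\<sigma> > 1" "twisted_sum N z (of_real \<sigma>) = 0"
      by (rule twisted_zero_if_Re_pos[OF diverges N \<delta> Re_pos])
    thus ?thesis
      using N by (rule zeros)
  qed
  obtain N0 where N0: "\<And>N z \<sigma>. N \<ge> N0 \<Longrightarrow> unimodular z \<Longrightarrow> \<sigma> > 1 \<Longrightarrow>
      Re (\<Sum>j=2..N. exp (twisted_log (\<lambda>p. z p ^ j) (of_nat j * of_real \<sigma>))) \<ge> 1"
    using twisted_tail_Re_pos_eventually by blast
  have large: "infinite (zeros_right_of_1 (\<lambda>s. \<Sum>j=1..N. L (of_nat j * s)))" if N: "N \<ge> max N0 1" for N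
    by (rule if_Re_pos[of N 1]) (use N N0[of N] in auto)
  have small_coeffs: "infinite (zeros_right_of_1 (\<lambda>s. \<Sum>j=1..N. L (of_nat j * s)))"
    if a: "\<forall>n\<ge>2. norm (a n) \<le> real n powr (1 / 4)" and N: "N \<ge> 2" for N
  proof (rule if_Re_pos)
    fix z and \<sigma> :: real assume z: "unimodular z" and \<sigma>: "\<sigma> > 1"
    have "Re (exp (twisted_log (\<lambda>p. z p ^ j) (of_nat j * of_real \<sigma>))) \<ge> 9/1000" if j: "j \<in> {2..N}" for j
    proof -
      have j\<sigma>: "Re (of_nat j * of_real \<sigma>) \<ge> 2"
        using mult_mono[of 2 "real j" 1 \<sigma>] j \<sigma> by simp
      have "norm (exp (twisted_log (\<lambda>p. z p ^ j) (of_nat j * of_real \<sigma>)) - 1) \<le> 991/1000"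
      proof (rule twisted_exp_minus_1_le[OF unimodular_power[OF z]])
        show "Re (of_nat j * of_real \<sigma>) > 1"
          using j\<sigma> by linarith
        fix s' assume "Re s' = Re (of_nat j * of_real \<sigma>)"
        hence s': "Re s' \<ge> 2" "Re s' > 1"
          using j\<sigma> by linarith+
        have "norm (dirichlet_series a s' - 1) \<le> 991/1000"
          using a by (intro norm_dirichlet_series_minus_1_le I coeffs s') auto
        thus "norm (exp (twisted_log (\<lambda>_. 1) s') - 1) \<le> 991/1000"
          using L_exp[OF s'(2)] by (simp add: L_def)
      qed
      thus ?thesis
        using abs_Re_le_cmod[of "exp (twisted_log (\<lambda>p. z p ^ j) (of_nat j * of_real \<sigma>)) - 1"] by simp
    qed
    hence "(\<Sum>j=2..N. 9/1000) \<le> (\<Sum>j=2..N. Re (exp (twisted_log (\<lambda>p. z p ^ j) (of_nat j * of_real \<sigma>))))"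
      by (rule sum_mono)
    moreover have "(\<Sum>j=2..N. 9/1000 :: real) \<ge> 9/1000"
      using N by simp
    ultimately show "Re (\<Sum>j=2..N. exp (twisted_log (\<lambda>p. z p ^ j) (of_nat j * of_real \<sigma>))) \<ge> 9/1000"
      by simp
  qed (use N in auto)
  show ?thesis
    using two large small_coeffs by blast
qed

end
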